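(* Let $k\ge2$ and consider the SOS model at inverse temperature $\beta>0$ on the Cayley tree of order $k$, with parameter $\tau=2\cosh(\beta)$. Call a spatially homogeneous $3$-periodic boundary law $z$ of type $( * )$ if, for some $a>0$, $$z_n=\begin{cases}1,& n\equiv 0\pmod 3,\\ a^k,& n\not\equiv 0\pmod 3,\end{cases}$$ and nontrivial if $a\neq1$. There are numbers $0<\tau_c<\tau_0$ (depending only on $k$) such that: 1. If $\tau<\tau_c$, then there is no gradient Gibbs measure $\nu^z$ associated to a nontrivial boundary law $z$ of type $( * )$. 2. If $\tau=\tau_c$, there is a unique gradient Gibbs measure associated to a nontrivial boundary law of type $( * )$. 3. If $\tau>\tau_c$ and $\tau\neq\tau_0$, there are exactly two gradient Gibbs measures associated to nontrivial boundary laws of type $( * )$; if $\tau=\tau_0$ there is exactly one. Moreover (for $k=2$, at the same $\beta$) the gradient Gibbs measures associated to nontrivial boundary laws of type $( * )$ are all different from the gradient Gibbs measures associated to $4$-periodic boundary laws of the form $z_n=1$ for $n\equiv0,2$, $z_n=a^2$ for $n\equiv1$, $z_n=b^2$ for $n\equiv3 \pmod 4$ with $a,b>0$.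
   Context: Cayley tree: the Cayley tree of order $k$ (also called $k$-regular tree here) is the infinite tree $(V,L)$ in which every vertex has exactly $k+1$ neighbours. Fix a root $\rho\in V$ and let $\vec L$ be the set of edges oriented away from $\rho$. For $\Lambda\subset V$, $\partial\Lambda$ denotes the set of vertices outside $\Lambda$ at distance $1$ from $\Lambda$. SOS model: the formal energy of a height configuration $\omega\in\mathbb Z^V$ is $\sum_{\langle x,y\rangle\in L}|\omega_x-\omega_y|$. With inverse temperature $\beta>0$ and $\theta=e^{-\beta}\in(0,1)$ the transfer operator is $Q(i-j)=\theta^{|i-j|}$, $i,j\in\mathbb Z$. Boundary laws: a spatially homogeneous boundary law is a function $l:\mathbb Z\to(0,\infty)$ for which there is a constant $c>0$ with $l(i)=c\big(\sum_{j\in\mathbb Z}Q(i-j)\,l(j)\big)^k$ for all $i\in\mathbb Z$ (sums finite). It is $q$-periodic if $l(i+q)=l(i)$ for all $i$. Gradient configurations: $\Omega^\nabla=\mathbb Z^{\vec L}$ with product $\sigma$-algebra; $\nabla:\mathbb Z^V\to\Omega^\nabla$, $(\nabla\omega)_{\langle x,y\rangle}=\omega_y-\omega_x$. For $\zeta\in\Omega^\nabla$ and $w,y\in V$ let $\sum_{b\in\Gamma(w,y)}\zeta_b$ denote the sum of height increments along the unique path from $w$ to $y$ (an edge traversed against its orientation contributes $-\zeta_b$), i.e. $\omega_y-\omega_w$ for any $\omega$ with $\nabla\omega=\zeta$. Gradient Gibbs measures (GGMs): for finite $\Lambda\subset V$ let $\gamma_\Lambda(\cdot\mid\omega)$ be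 the Gibbs kernel on $\mathbb Z^V$ which fixes $\omega$ outside $\Lambda$ and gives $\sigma_\Lambda\in\mathbb Z^\Lambda$ probability proportional to $\prod_{b\cap\Lambda\ne\emptyset}Q$ (height difference along $b$). Let $\gamma'_\Lambda(\cdot\mid\zeta)$ be the image of $\gamma_\Lambda(\cdot\mid\omega)$ under $\nabla$, for any $\omega$ with $\nabla\omega=\zeta$. A probability measure $\nu$ on $\Omega^\nabla$ is a GGM if $\int\nu(d\zeta)F(\zeta)=\int\nu(d\zeta)\int\gamma'_\Lambda(d\tilde\zeta\mid\zeta)F(\tilde\zeta)$ for all finite $\Lambda\subset V$ and all bounded measurable $F$. GGM associated to a periodic boundary law: if $l$ is a spatially homogeneous $q$-periodic boundary law, $\nu^l$ is the probability measure on $\Omega^\nabla$ such that for every finite nonempty connected $\Lambda\subset V$ and any $w\in\Lambda$, $$\nu^l(\eta_{\Lambda\cup\partial\Lambda}=\zeta_{\Lambda\cup\partial\Lambda})=Z_\Lambda\Big(\sum_{s\in\mathbb Z_q}\prod_{y\in\partial\Lambda}l\big(s+\sum_{b\in\Gamma(w,y)}\zeta_b\big)\Big)\prod_{b\cap\Lambda\neq\emptyset}Q(\zeta_b),$$ where $\zeta_{\Lambda\cup\partial\Lambda}$ assigns integers to the edges inside $\Lambda\cup\partial\Lambda$ and $Z_\Lambda$ is a normalization constant. It is a known fact, which may be taken as given, that this defines a (tree-automorphism invariant) GGM. *)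

theory Defs
  imports "HOL-Probability.Probability"
begin

section \<open>Cayley trees\<close>

text \<open>An undirected graph is a vertex set \<open>V\<close> together with a set \<open>L\<close> of two-element edges.\<close>

definition is_path :: "'v set set \<Rightarrow> 'v \<Rightarrow> 'v list \<Rightarrow> 'v \<Rightarrow> bool" where
  "is_path L x p y \<longleftrightarrow> p \<noteq> [] \<and> hd p = x \<and> last p = y \<and> distinct p \<and>
     successively (\<lambda>u v. {u, v} \<in> L) p"

definition is_cycle :: "'v set set \<Rightarrow> 'v list \<Rightarrow> bool" where
  "is_cycle L p \<longleftrightarrow> 3 \<le> length p \<and> distinct p \<and>
     successively (\<lambda>u v. {u, v} \<in> L) p \<and> {last p, hd p} \<in> L"

definition connected_in :: "'v set set \<Rightarrow> 'v set \<Rightarrow> bool" where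
  "connected_in L A \<longleftrightarrow> (\<forall>x\<in>A. \<forall>y\<in>A. \<exists>p. is_path L x p y \<and> set p \<subseteq> A)"

definition cayley_tree :: "nat \<Rightarrow> 'v set \<Rightarrow> 'v set set \<Rightarrow> bool" where
  "cayley_tree k V L \<longleftrightarrow>
     V \<noteq> {} \<and>
     (\<forall>e\<in>L. \<exists>x\<in>V. \<exists>y\<in>V. x \<noteq> y \<and> e = {x, y}) \<and>
     connected_in L V \<and>
     (\<nexists>p. is_cycle L p) \<and>
     (\<forall>x\<in>V. card {y \<in> V. {x, y} \<in> L} = k + 1)"

definition tree_path :: "'v set set \<Rightarrow> 'v \<Rightarrow> 'v \<Rightarrow> 'v list" where
  "tree_path L x y = (THE p. is_path L x p y)"

definition tree_dist :: "'v set set \<Rightarrow> 'v \<Rightarrow> 'v \<Rightarrow> nat" where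
  "tree_dist L x y = length (tree_path L x y) - 1"

text \<open>The edges, oriented away from the root \<open>r\<close>.\<close>

definition oriented_edges :: "'v set set \<Rightarrow> 'v \<Rightarrow> ('v \<times> 'v) set" where
  "oriented_edges L r = {(x, y). {x, y} \<in> L \<and> tree_dist L r y = tree_dist L r x + 1}"

definition outer_boundary :: "'v set \<Rightarrow> 'v set set \<Rightarrow> 'v set \<Rightarrow> 'v set" where
  "outer_boundary V L \<Lambda> = {y \<in> V - \<Lambda>. \<exists>x\<in>\<Lambda>. {x, y} \<in> L}"

definition edges_touching :: "('v \<times> 'v) set \<Rightarrow> 'v set \<Rightarrow> ('v \<times> 'v) set" where
  "edges_touching D \<Lambda> = {(x, y) \<in> D. x \<in> \<Lambda> \<or> y \<in> \<Lambda>}"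

definition edges_inside :: "('v \<times> 'v) set \<Rightarrow> 'v set \<Rightarrow> ('v \<times> 'v) set" where
  "edges_inside D \<Lambda> = {(x, y) \<in> D. x \<in> \<Lambda> \<and> y \<in> \<Lambda>}"


section \<open>Height and gradient configurations\<close>

definition height_space :: "'v set \<Rightarrow> ('v \<Rightarrow> int) measure" where
  "height_space V = (\<Pi>\<^sub>M x\<in>V. count_space UNIV)"

definition grad_space :: "('v \<times> 'v) set \<Rightarrow> ('v \<times> 'v \<Rightarrow> int) measure" where
  "grad_space D = (\<Pi>\<^sub>M b\<in>D. count_space UNIV)"

definition grad :: "('v \<times> 'v) set \<Rightarrow> ('v \<Rightarrow> int) \<Rightarrow> ('v \<times> 'v \<Rightarrow> int)" where
  "grad D \<omega> = (\<lambda>(x, y)\<in>D. \<omega> y - \<omega> x)"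

definition edge_increment :: "('v \<times> 'v) set \<Rightarrow> ('v \<times> 'v \<Rightarrow> int) \<Rightarrow> 'v \<Rightarrow> 'v \<Rightarrow> int" where
  "edge_increment D \<zeta> x y = (if (x, y) \<in> D then \<zeta> (x, y) else - \<zeta> (y, x))"

definition path_increment ::
  "'v set set \<Rightarrow> ('v \<times> 'v) set \<Rightarrow> ('v \<times> 'v \<Rightarrow> int) \<Rightarrow> 'v \<Rightarrow> 'v \<Rightarrow> int" where
  "path_increment L D \<zeta> w y =
     (let p = tree_path L w y in \<Sum>(u, v)\<leftarrow>zip p (tl p). edge_increment D \<zeta> u v)"


section \<open>The SOS model\<close>

definition sos_Q :: "real \<Rightarrow> int \<Rightarrow> real" where
  "sos_Q \<beta> m = exp (- \<beta>) ^ nat \<bar>m\<bar>"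

text \<open>\<open>splice V \<Lambda> \<sigma> \<omega>\<close> is the height configuration \<open>\<sigma>\<close> on \<open>\<Lambda>\<close> and \<open>\<omega>\<close> on \<open>V - \<Lambda>\<close>.\<close>

definition splice :: "'v set \<Rightarrow> 'v set \<Rightarrow> ('v \<Rightarrow> int) \<Rightarrow> ('v \<Rightarrow> int) \<Rightarrow> ('v \<Rightarrow> int)" where
  "splice V \<Lambda> \<sigma> \<omega> = (\<lambda>x\<in>V. if x \<in> \<Lambda> then \<sigma> x else \<omega> x)"

definition local_weight ::
  "('v \<times> 'v) set \<Rightarrow> real \<Rightarrow> 'v set \<Rightarrow> ('v \<Rightarrow> int) \<Rightarrow> real" where
  "local_weight D \<beta> \<Lambda> \<omega> = (\<Prod>(x, y)\<in>edges_touching D \<Lambda>. sos_Q \<beta> (\<omega> y - \<omega> x))"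

definition gibbs_kernel ::
  "'v set \<Rightarrow> ('v \<times> 'v) set \<Rightarrow> real \<Rightarrow> 'v set \<Rightarrow> ('v \<Rightarrow> int) \<Rightarrow> ('v \<Rightarrow> int) measure" where
  "gibbs_kernel V D \<beta> \<Lambda> \<omega> =
     (let w = (\<lambda>\<sigma>. local_weight D \<beta> \<Lambda> (splice V \<Lambda> \<sigma> \<omega>));
          S = \<Lambda> \<rightarrow>\<^sub>E (UNIV :: int set)
      in distr (point_measure S (\<lambda>\<sigma>. ennreal (w \<sigma> / (\<Sum>\<^sub>\<infinity>\<sigma>'\<in>S. w \<sigma>'))))
           (height_space V) (\<lambda>\<sigma>. splice V \<Lambda> \<sigma> \<omega>))"

text \<open>On a tree a gradient configuration determines the heights up to a global additive constant,
  and the measure below does not depend on that constant, hence not on the choice of \<open>\<omega>\<close>.\<close>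

definition grad_kernel ::
  "'v set \<Rightarrow> ('v \<times> 'v) set \<Rightarrow> real \<Rightarrow> 'v set \<Rightarrow> ('v \<times> 'v \<Rightarrow> int) \<Rightarrow> ('v \<times> 'v \<Rightarrow> int) measure" where
  "grad_kernel V D \<beta> \<Lambda> \<zeta> =
     distr (gibbs_kernel V D \<beta> \<Lambda> (SOME \<omega>. \<omega> \<in> space (height_space V) \<and> grad D \<omega> = \<zeta>))
       (grad_space D) (grad D)"

definition gradient_gibbs_measure ::
  "'v set \<Rightarrow> 'v set set \<Rightarrow> 'v \<Rightarrow> real \<Rightarrow> ('v \<times> 'v \<Rightarrow> int) measure \<Rightarrow> bool" where
  "gradient_gibbs_measure V L r \<beta> \<nu> \<longleftrightarrow>
     (let D = oriented_edges L r in
       prob_space \<nu> \<and> sets \<nu> = sets (grad_space D) \<and>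
       (\<forall>\<Lambda>. finite \<Lambda> \<and> \<Lambda> \<subseteq> V \<longrightarrow>
         (\<forall>F::('v \<times> 'v \<Rightarrow> int) \<Rightarrow> real.
            F \<in> borel_measurable (grad_space D) \<and> bounded (F ` space (grad_space D)) \<longrightarrow>
            (\<integral>\<zeta>. F \<zeta> \<partial>\<nu>) = (\<integral>\<zeta>. (\<integral>\<zeta>'. F \<zeta>' \<partial>grad_kernel V D \<beta> \<Lambda> \<zeta>) \<partial>\<nu>))))"


section \<open>Boundary laws\<close>

definition homogeneous_boundary_law :: "nat \<Rightarrow> real \<Rightarrow> (int \<Rightarrow> real) \<Rightarrow> bool" where
  "homogeneous_boundary_law k \<beta> l \<longleftrightarrow>
     (\<forall>i. 0 < l i) \<and>
     (\<forall>i. (\<lambda>j. sos_Q \<beta> (i - j) * l j) summable_on UNIV) \<and>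
     (\<exists>c>0. \<forall>i. l i = c * (\<Sum>\<^sub>\<infinity>j\<in>UNIV. sos_Q \<beta> (i - j) * l j) ^ k)"

definition periodic_law :: "nat \<Rightarrow> (int \<Rightarrow> real) \<Rightarrow> bool" where
  "periodic_law q l \<longleftrightarrow> (\<forall>i. l (i + int q) = l i)"

text \<open>\<open>\<nu>\<close> is the measure associated to the \<open>q\<close>-periodic law \<open>l\<close>. The marginal on the edges
  inside \<open>\<Lambda> \<union> \<partial>\<Lambda>\<close> is expressed through cylinder events of full gradient configurations.\<close>

definition associated_measure ::
  "'v set \<Rightarrow> 'v set set \<Rightarrow> 'v \<Rightarrow> real \<Rightarrow> nat \<Rightarrow> (int \<Rightarrow> real) \<Rightarrow> ('v \<times> 'v \<Rightarrow> int) measure \<Rightarrow> bool" where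
  "associated_measure V L r \<beta> q l \<nu> \<longleftrightarrow>
     (let D = oriented_edges L r in
       prob_space \<nu> \<and> sets \<nu> = sets (grad_space D) \<and>
       (\<forall>\<Lambda>. finite \<Lambda> \<and> \<Lambda> \<noteq> {} \<and> \<Lambda> \<subseteq> V \<and> connected_in L \<Lambda> \<longrightarrow>
         (\<exists>Z>0. \<forall>w\<in>\<Lambda>. \<forall>\<zeta>\<in>space (grad_space D).
            measure \<nu> {\<eta> \<in> space (grad_space D).
                        \<forall>b\<in>edges_inside D (\<Lambda> \<union> outer_boundary V L \<Lambda>). \<eta> b = \<zeta> b} =
            Z * (\<Sum>s<q. \<Prod>y\<in>outer_boundary V L \<Lambda>. l (int s + path_increment L D \<zeta> w y)) *
            (\<Prod>b\<in>edges_touching D \<Lambda>. sos_Q \<beta> (\<zeta> b)))))"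

definition three_law :: "nat \<Rightarrow> real \<Rightarrow> int \<Rightarrow> real" where
  "three_law k a n = (if n mod 3 = 0 then 1 else a ^ k)"

definition nontrivial_three_laws :: "nat \<Rightarrow> real \<Rightarrow> (int \<Rightarrow> real) set" where
  "nontrivial_three_laws k \<beta> =
     {z. homogeneous_boundary_law k \<beta> z \<and> (\<exists>a>0. a \<noteq> 1 \<and> z = three_law k a)}"

definition four_law :: "real \<Rightarrow> real \<Rightarrow> int \<Rightarrow> real" where
  "four_law a b n = (if n mod 4 = 1 then a\<^sup>2 else if n mod 4 = 3 then b\<^sup>2 else 1)"

definition four_laws :: "real \<Rightarrow> (int \<Rightarrow> real) set" where
  "four_laws \<beta> =
     {z. homogeneous_boundary_law 2 \<beta> z \<and> (\<exists>a>0. \<exists>b>0. z = four_law a b)}"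

text \<open>The gradient Gibbs measures associated to some \<open>q\<close>-periodic law in the class \<open>B\<close>.\<close>

definition ggms_of ::
  "'v set \<Rightarrow> 'v set set \<Rightarrow> 'v \<Rightarrow> real \<Rightarrow> nat \<Rightarrow> (int \<Rightarrow> real) set \<Rightarrow> ('v \<times> 'v \<Rightarrow> int) measure set" where
  "ggms_of V L r \<beta> q B =
     {\<nu>. gradient_gibbs_measure V L r \<beta> \<nu> \<and> (\<exists>z\<in>B. associated_measure V L r \<beta> q z \<nu>)}"

end

theory Submission
  imports Defs
begin

text \<open>With \<open>x = a ^ k\<close>, the law of type \<open>(*)\<close> is a boundary law iff
  \<open>a * (\<tau> - 1 + 2 * x) = 1 + \<tau> * x\<close>. Dividing out the root \<open>a = 1\<close> leaves
  \<open>\<tau> - 2 = (2 * a ^ k + 1) / (a + \<dots> + a ^ (k - 1))\<close>, whose right-hand side decreases and then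
  increases, with its minimum at some \<open>c < 1\<close>; the level through \<open>a = 1\<close> gives \<open>\<tau>\<^sub>0\<close>.

  A measure is determined by its law, because the normalization constants are fixed by total mass
  1. Conversely the marginal at the single vertex \<open>r\<close> determines \<open>a\<close>: writing \<open>F\<close> for its
  boundary-law sum as a function of the increments to the neighbours, a quotient of differences
  of values of \<open>F\<close> equals \<open>1 + 1 / (x + \<dots> + x ^ (k - 1))\<close>. A measure with
  both a 3-periodic and a 4-periodic law would have \<open>F\<close> invariant under unit shifts of each
  increment, which forces \<open>x = 1\<close>.\<close>

section \<open>The equation for three-periodic laws\<close>

text \<open>The progression is cut at m = 0. For m = -n the distance is i + p n, for m = n + 1 it is
  (p - i) + p n, so each half is a geometric series of ratio \<theta>^p. The bound
  \<open>i \<le> p\<close> keeps the second distance nonnegative.\<close>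

lemma has_sum_sos_Q_progression:
  fixes p i :: nat
  assumes "\<beta> > 0" and "i \<le> p" and "p > 0"
  defines "\<theta> \<equiv> exp (- \<beta>)"
  shows "((\<lambda>m. sos_Q \<beta> (int i - int p * m)) has_sum ((\<theta> ^ i + \<theta> ^ (p - i)) / (1 - \<theta> ^ p))) UNIV"
proof -
  have th: "0 < \<theta>" "\<theta> < 1" using assms by auto
  hence thp: "norm (\<theta> ^ p) < 1" using assms by (simp add: power_less_one_iff)
  have geo: "((\<lambda>n. c * (\<theta> ^ p) ^ n) has_sum (c * (1 / (1 - \<theta> ^ p)))) UNIV" for c
    by (intro has_sum_cmult_right norm_summable_imp_has_sum geometric_sums thp)
       (use thp in \<open>simp add: norm_power power_abs[symmetric] th(1) less_imp_le\<close>)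
  have "((\<lambda>m. sos_Q \<beta> (int i - int p * m)) has_sum (\<theta> ^ i * (1 / (1 - \<theta> ^ p)))) {..0}"
  proof -
    have "bij_betw (\<lambda>n. - int n) UNIV {..0}"
      by (rule bij_betw_byWitness[where f' = "\<lambda>m. nat (- m)"]) auto
    moreover have "sos_Q \<beta> (int i - int p * (- int n)) = \<theta> ^ i * (\<theta> ^ p) ^ n" for n
    proof -
      have "nat \<bar>int i - int p * (- int n)\<bar> = i + p * n"
        by (simp add: nat_add_distrib nat_mult_distrib)
      thus ?thesis by (simp only: sos_Q_def \<theta>_def power_add power_mult)
    qed
    ultimately show ?thesis
      using geo[of "\<theta> ^ i"] has_sum_reindex_bij_betw[of "\<lambda>n. - int n" UNIV "{..0}" "\<lambda>m. sos_Q \<beta> (int i - int p * m)"]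
      by simp
  qed
  moreover have "((\<lambda>m. sos_Q \<beta> (int i - int p * m)) has_sum (\<theta> ^ (p - i) * (1 / (1 - \<theta> ^ p)))) {0<..}"
  proof -
    have "bij_betw (\<lambda>n. int n + 1) UNIV {0<..}"
      by (rule bij_betw_byWitness[where f' = "\<lambda>m. nat (m - 1)"]) auto
    moreover have "sos_Q \<beta> (int i - int p * (int n + 1)) = \<theta> ^ (p - i) * (\<theta> ^ p) ^ n" for n
    proof -
      have "int i - int p * (int n + 1) = - int ((p - i) + p * n)"
        using assms(2) by (simp add: algebra_simps of_nat_diff)
      hence "nat \<bar>int i - int p * (int n + 1)\<bar> = (p - i) + p * n"
        by (metis abs_minus_cancel nat_abs_int_diff nat_int abs_of_nat)
      thus ?thesis by (simp only: sos_Q_def \<theta>_def power_add power_mult)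
    qed
    ultimately show ?thesis
      using geo[of "\<theta> ^ (p - i)"] has_sum_reindex_bij_betw[of "\<lambda>n. int n + 1" UNIV "{0<..}" "\<lambda>m. sos_Q \<beta> (int i - int p * m)"]
      by simp
  qed
  ultimately have "((\<lambda>m. sos_Q \<beta> (int i - int p * m)) has_sum
      (\<theta> ^ i * (1 / (1 - \<theta> ^ p)) + \<theta> ^ (p - i) * (1 / (1 - \<theta> ^ p)))) ({..0} \<union> {0<..})"
    by (rule has_sum_Un_disjoint) auto
  moreover have "{..0} \<union> {0<..} = (UNIV :: int set)" by auto
  ultimately show ?thesis by (simp add: add_divide_distrib)
qed

lemma periodic_law_three_law: "periodic_law 3 (three_law k a)"
  by (simp add: periodic_law_def three_law_def)

text \<open>The law is the constant a^k plus (1 - a^k) times the indicator of the multiples of 3.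
  The constant part is a progression of step 1, the indicator part one of step 3.\<close>

lemma has_sum_sos_Q_three_law:
  fixes i :: nat
  assumes "\<beta> > 0" and "i < 3"
  defines "\<theta> \<equiv> exp (- \<beta>)"
  shows "((\<lambda>j. sos_Q \<beta> (int i - j) * three_law k a j) has_sum
    (a ^ k * ((1 + \<theta>) / (1 - \<theta>)) + (1 - a ^ k) * ((\<theta> ^ i + \<theta> ^ (3 - i)) / (1 - \<theta> ^ 3)))) UNIV"
proof -
  have "((\<lambda>m. sos_Q \<beta> (0 - m)) has_sum ((1 + \<theta>) / (1 - \<theta>))) UNIV"
    using has_sum_sos_Q_progression[OF assms(1), of 0 1] by (simp add: \<theta>_def)
  hence A: "((\<lambda>m. sos_Q \<beta> (int i - m)) has_sum ((1 + \<theta>) / (1 - \<theta>))) UNIV"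
    using has_sum_reindex_bij_betw[of "\<lambda>m. m - int i" UNIV UNIV "\<lambda>m. sos_Q \<beta> (0 - m)"]
      bij_betw_byWitness[of UNIV "\<lambda>m. m + int i" "\<lambda>m. m - int i" UNIV] by simp
  have inj: "inj (\<lambda>m::int. 3 * m)" by (auto intro: injI)
  have "((\<lambda>m. sos_Q \<beta> (int i - 3 * m)) has_sum ((\<theta> ^ i + \<theta> ^ (3 - i)) / (1 - \<theta> ^ 3))) UNIV"
    using has_sum_sos_Q_progression[OF assms(1), of i 3] assms(2) by (simp add: \<theta>_def)
  hence "((\<lambda>j. sos_Q \<beta> (int i - j)) has_sum ((\<theta> ^ i + \<theta> ^ (3 - i)) / (1 - \<theta> ^ 3))) (range (\<lambda>m. 3 * m))"
    using has_sum_reindex[OF inj, of "\<lambda>j. sos_Q \<beta> (int i - j)"] by (simp add: o_def)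
  hence B: "((\<lambda>j. if j mod 3 = 0 then sos_Q \<beta> (int i - j) else 0) has_sum
      ((\<theta> ^ i + \<theta> ^ (3 - i)) / (1 - \<theta> ^ 3))) UNIV"
  proof (rule iffD1[OF has_sum_cong_neutral, rotated 3])
    show "sos_Q \<beta> (int i - j) = (if j mod 3 = 0 then sos_Q \<beta> (int i - j) else 0)"
      if "j \<in> range ((*) 3) \<inter> UNIV" for j
      using that by auto
    show "sos_Q \<beta> (int i - j) = 0" if "j \<in> range ((*) 3) - UNIV" for j
      using that by auto
    show "(if j mod 3 = 0 then sos_Q \<beta> (int i - j) else 0) = 0" if "j \<in> UNIV - range ((*) 3)" for j
      using that by (auto simp: image_iff elim!: dvdE simp flip: dvd_eq_mod_eq_0)
  qed
  have "(\<lambda>j. sos_Q \<beta> (int i - j) * three_law k a j) =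
     (\<lambda>j. a ^ k * sos_Q \<beta> (int i - j) + (1 - a ^ k) * (if j mod 3 = 0 then sos_Q \<beta> (int i - j) else 0))"
    by (auto simp: three_law_def algebra_simps)
  thus ?thesis
    using has_sum_add[OF has_sum_cmult_right[OF A, of "a ^ k"] has_sum_cmult_right[OF B, of "1 - a ^ k"]]
    by simp
qed

text \<open>Translating the summation index by a multiple of q leaves the law unchanged, so the sums
  need to be computed only at representatives of the residues mod q.\<close>

lemma has_sum_sos_Q_periodic:
  assumes "periodic_law q l" and "((\<lambda>j. sos_Q \<beta> (i - j) * l j) has_sum S) UNIV"
  shows "((\<lambda>j. sos_Q \<beta> (i + int q * m - j) * l j) has_sum S) UNIV"
proof -
  have up: "l (j + int q * int n) = l j" for j n
  proof (induction n)
    case (Suc n)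
    have "l ((j + int q * int n) + int q) = l (j + int q * int n)"
      using assms(1) by (simp add: periodic_law_def)
    thus ?case using Suc by (simp add: algebra_simps)
  qed simp
  have per: "l (j + int q * m) = l j" for j
  proof (cases m rule: int_cases2)
    case (nonneg n) thus ?thesis using up by simp
  next
    case (nonpos n) thus ?thesis using up[of "j + int q * m" n] by simp
  qed
  have "bij_betw (\<lambda>j. j - int q * m) UNIV UNIV"
    by (rule bij_betw_byWitness[where f' = "\<lambda>j. j + int q * m"]) auto
  from has_sum_reindex_bij_betw[OF this, of "\<lambda>j. sos_Q \<beta> (i - j) * l j" S] assms(2)
  have "((\<lambda>j. sos_Q \<beta> (i - (j - int q * m)) * l (j - int q * m)) has_sum S) UNIV" by simp
  moreover have "l (j - int q * m) = l j" for j using per[of "j - int q * m"] by simp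
  ultimately show ?thesis by (simp add: algebra_simps)
qed

text \<open>The formula for the sums is symmetric under i -> 3 - i, so heights 1 and 2 give the same
  condition and two equations remain, 1 = c (S 0)^k and a^k = c (S 1)^k. Eliminating c and taking
  k-th roots of positive numbers leaves a S 0 = S 1, from which a common positive factor drops
  out.\<close>

lemma homogeneous_boundary_law_three_law_iff:
  assumes b: "\<beta> > 0" and k: "k \<ge> 1" and a: "a > 0"
  defines "\<tau> \<equiv> 2 * cosh \<beta>"
  shows "homogeneous_boundary_law k \<beta> (three_law k a) \<longleftrightarrow>
    a * (\<tau> - 1 + 2 * a ^ k) = 1 + \<tau> * a ^ k"
proof -
  define \<theta> where "\<theta> = exp (- \<beta>)"
  have th: "0 < \<theta>" "\<theta> < 1" using b by (auto simp: \<theta>_def)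
  have th3: "0 < 1 - \<theta> ^ 3" using th by (simp add: power_less_one_iff)
  have tau: "\<tau> * \<theta> = \<theta>\<^sup>2 + 1"
    by (simp add: \<tau>_def cosh_def \<theta>_def algebra_simps power2_eq_square exp_minus)
  define S where "S i = a ^ k * ((1 + \<theta>) / (1 - \<theta>)) + (1 - a ^ k) * ((\<theta> ^ i + \<theta> ^ (3 - i)) / (1 - \<theta> ^ 3))" for i :: nat
  \<comment> \<open>\<open>u\<close> is the total weight, seen from height 0, of one nonzero residue
    class mod 3. Through \<tau> \<theta> = \<theta>^2 + 1 it becomes a factor of all the sums,
    leaving expressions in \<tau> and a^k only.\<close>
  define u where "u = \<theta> * (1 + \<theta>) / (1 - \<theta> ^ 3)"
  have u: "u > 0" using th th3 by (simp add: u_def)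
  have fac: "1 - \<theta> ^ 3 = (1 - \<theta>) * (1 + \<theta> + \<theta>\<^sup>2)" by (simp add: algebra_simps power3_eq_cube power2_eq_square)
  have T: "(1 + \<theta>) / (1 - \<theta>) = (\<tau> + 1) * u"
  proof -
    have "(\<tau> + 1) * u = (\<tau> * \<theta> + \<theta>) * (1 + \<theta>) / (1 - \<theta> ^ 3)"
      by (simp add: u_def algebra_simps)
    also have "\<dots> = (1 + \<theta>) * (1 + \<theta> + \<theta>\<^sup>2) / ((1 - \<theta>) * (1 + \<theta> + \<theta>\<^sup>2))"
      unfolding tau fac by (simp add: algebra_simps)
    also have "\<dots> = (1 + \<theta>) / (1 - \<theta>)"
      using th fac th3 by (intro nonzero_mult_divide_mult_cancel_right) auto
    finally show ?thesis by simp
  qed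
  have U0: "(\<theta> ^ 0 + \<theta> ^ (3 - 0)) / (1 - \<theta> ^ 3) = (\<tau> - 1) * u"
  proof -
    have "(\<tau> - 1) * u = (\<tau> * \<theta> - \<theta>) * (1 + \<theta>) / (1 - \<theta> ^ 3)"
      by (simp add: u_def algebra_simps)
    also have "\<dots> = (1 + \<theta> ^ 3) / (1 - \<theta> ^ 3)"
      unfolding tau by (simp add: algebra_simps power2_eq_square power3_eq_cube)
    finally show ?thesis by simp
  qed
  have S0: "S 0 = u * (\<tau> - 1 + 2 * a ^ k)" unfolding S_def T U0 by (simp add: algebra_simps)
  have U1: "(\<theta> + \<theta>\<^sup>2) / (1 - \<theta> ^ 3) = u"
    by (simp add: u_def power2_eq_square distrib_left)
  have S1: "S 1 = u * (1 + \<tau> * a ^ k)"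
    using U1 by (simp add: S_def T algebra_simps)
  have S2: "S 2 = S 1" by (simp add: S_def add.commute)
  have t2: "\<tau> > 2" using cosh_real_strict_mono[of 0 \<beta>] b by (simp add: \<tau>_def)
  have pos: "S 0 > 0" "S 1 > 0" unfolding S0 S1 using u a t2 by (auto intro!: mult_pos_pos add_pos_pos)
  have hs: "((\<lambda>j. sos_Q \<beta> (i - j) * three_law k a j) has_sum S (nat (i mod 3))) UNIV" for i
  proof -
    have "nat (i mod 3) < 3" by simp
    from has_sum_sos_Q_periodic[OF periodic_law_three_law has_sum_sos_Q_three_law[OF b this, of k a], of "i div 3"]
    show ?thesis by (simp add: S_def \<theta>_def)
  qed
  have inf: "(\<Sum>\<^sub>\<infinity>j\<in>UNIV. sos_Q \<beta> (i - j) * three_law k a j) = S (nat (i mod 3))" for i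
    using hs by (rule infsumI)
  have m3: "S (nat (i mod 3)) = (if i mod 3 = 0 then S 0 else S 1)" for i :: int
  proof -
    have "i mod 3 = 0 \<or> i mod 3 = 1 \<or> i mod 3 = 2" by presburger
    thus ?thesis using S2 by auto
  qed
  have "homogeneous_boundary_law k \<beta> (three_law k a) \<longleftrightarrow>
      (\<exists>c>0. \<forall>i. three_law k a i = c * (if i mod 3 = 0 then S 0 else S 1) ^ k)"
    unfolding homogeneous_boundary_law_def inf m3
    using hs a by (auto simp: summable_on_def three_law_def)
  also have "\<dots> \<longleftrightarrow> (\<exists>c>0. 1 = c * S 0 ^ k \<and> a ^ k = c * S 1 ^ k)"
  proof -
    have "(\<forall>i. three_law k a i = c * (if i mod 3 = 0 then S 0 else S 1) ^ k) \<longleftrightarrow>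
        1 = c * S 0 ^ k \<and> a ^ k = c * S 1 ^ k" for c
    proof safe
      assume H: "\<forall>i. three_law k a i = c * (if i mod 3 = 0 then S 0 else S 1) ^ k"
      show "1 = c * S 0 ^ k" using H[rule_format, of 0] by (simp add: three_law_def)
      show "a ^ k = c * S 1 ^ k" using H[rule_format, of 1] by (simp add: three_law_def)
    qed (auto simp: three_law_def)
    thus ?thesis by simp
  qed
  also have "\<dots> \<longleftrightarrow> (a * S 0) ^ k = S 1 ^ k"
  proof
    assume "\<exists>c>0. 1 = c * S 0 ^ k \<and> a ^ k = c * S 1 ^ k"
    then obtain c where c: "1 = c * S 0 ^ k" "a ^ k = c * S 1 ^ k" by blast
    have "(a * S 0) ^ k = (c * S 0 ^ k) * S 1 ^ k" by (simp add: power_mult_distrib c(2))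
    thus "(a * S 0) ^ k = S 1 ^ k" using c(1) by simp
  next
    assume H: "(a * S 0) ^ k = S 1 ^ k"
    have "a ^ k = (1 / S 0 ^ k) * S 1 ^ k"
      unfolding H[symmetric] using pos by (simp add: power_mult_distrib)
    moreover have "1 = (1 / S 0 ^ k) * S 0 ^ k" "1 / S 0 ^ k > 0" using pos by simp_all
    ultimately show "\<exists>c>0. 1 = c * S 0 ^ k \<and> a ^ k = c * S 1 ^ k" by blast
  qed
  also have "\<dots> \<longleftrightarrow> a * S 0 = S 1"
    using pos a k by (intro power_eq_iff_eq_base) auto
  also have "\<dots> \<longleftrightarrow> a * (\<tau> - 1 + 2 * a ^ k) = 1 + \<tau> * a ^ k"
    using u unfolding S0 S1 by (simp add: mult.left_commute)
  finally show ?thesis .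
qed

section \<open>Level sets of the parameter curve\<close>

text \<open>Each side of c holds exactly one solution: existence by the intermediate value theorem,
  uniqueness by strict monotonicity of the branch. Since t lies above f c, neither solution is c, so
  the two are distinct.\<close>

lemma card_two_sided_level_set:
  fixes f :: "real \<Rightarrow> real"
  assumes c: "0 < c"
    and cont: "continuous_on {0<..} f"
    and dec: "\<And>x y. 0 < x \<Longrightarrow> x < y \<Longrightarrow> y \<le> c \<Longrightarrow> f y < f x"
    and inc: "\<And>x y. c \<le> x \<Longrightarrow> x < y \<Longrightarrow> f x < f y"
    and left: "\<And>t. \<exists>x>0. x < c \<and> t < f x"
    and right: "\<And>t. \<exists>x>c. t < f x"
    and t: "f c < t"
  shows "card {x. 0 < x \<and> f x = t} = 2"
proof -
  have cont': "continuous_on {x..y} f" if "0 < x" for x y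
    by (rule continuous_on_subset[OF cont]) (use that in auto)
  obtain l where l: "0 < l" "l < c" "t < f l" using left by blast
  obtain r where r: "c < r" "t < f r" using right by blast
  have "\<exists>x\<ge>l. x \<le> c \<and> f x = t"
    using l t cont' by (intro IVT2') auto
  then obtain x where x: "l \<le> x" "x \<le> c" "f x = t" by blast
  have "\<exists>y\<ge>c. y \<le> r \<and> f y = t"
    using r t cont' c by (intro IVT') auto
  then obtain y where y: "c \<le> y" "y \<le> r" "f y = t" by blast
  have xy: "x < c" "c < y" using x y t by (auto simp: less_le)
  have "{x. 0 < x \<and> f x = t} = {x, y}"
  proof (intro equalityI subsetI)
    fix z assume "z \<in> {x. 0 < x \<and> f x = t}"
    hence z: "0 < z" "f z = t" by auto
    show "z \<in> {x, y}"
    proof (cases "z \<le> c")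
      case True
      thus ?thesis using dec[of z x] dec[of x z] x z l by (cases z x rule: linorder_cases) auto
    next
      case False
      thus ?thesis using inc[of z y] inc[of y z] y z by (cases z y rule: linorder_cases) auto
    qed
  qed (use x y l c in auto)
  thus ?thesis using xy by simp
qed

section \<open>The parameter curve and its single turning point\<close>

definition tau_curve :: "nat \<Rightarrow> real \<Rightarrow> real" where
  "tau_curve k a = (2 * a ^ k + 1) / (\<Sum>j\<in>{1..<k}. a ^ j)"

lemma sum_powers_pos:
  fixes a :: real
  assumes "k \<ge> 2" and "a > 0"
  shows "(\<Sum>j\<in>{1..<k}. a ^ j) > 0"
  using assms by (intro sum_pos) auto

text \<open>The equation rearranges to (a - 1)(2 a^k + 1) = (\<tau> - 2)(a^k - a), and a^k - a = (a
  - 1)(a + ... + a^(k-1)), so the factor a - 1 of the trivial solution cancels.\<close>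

lemma three_law_equation_iff:
  fixes a \<tau> :: real
  assumes k: "k \<ge> 2" and a: "a > 0" "a \<noteq> 1"
  shows "a * (\<tau> - 1 + 2 * a ^ k) = 1 + \<tau> * a ^ k \<longleftrightarrow> tau_curve k a = \<tau> - 2"
proof -
  define P where "P = (\<Sum>j\<in>{1..<k}. a ^ j)"
  have "(a - 1) * (P + 1) = a ^ k - 1"
  proof -
    have "P + 1 = (\<Sum>j<k. a ^ j)"
      using k unfolding P_def lessThan_atLeast0 by (subst (2) sum.atLeast_Suc_lessThan) auto
    thus ?thesis by (simp add: power_diff_1_eq)
  qed
  hence P: "(a - 1) * P = a ^ k - a" by (simp add: algebra_simps)
  have "(a * (\<tau> - 1 + 2 * a ^ k) = 1 + \<tau> * a ^ k) \<longleftrightarrow>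
      (a - 1) * (2 * a ^ k + 1) = (\<tau> - 2) * (a ^ k - a)"
    by (auto simp: algebra_simps)
  also have "\<dots> \<longleftrightarrow> (a - 1) * (2 * a ^ k + 1) = (a - 1) * ((\<tau> - 2) * P)"
    unfolding P[symmetric] by (simp add: mult.left_commute)
  also have "\<dots> \<longleftrightarrow> 2 * a ^ k + 1 = (\<tau> - 2) * P" using a by simp
  also have "\<dots> \<longleftrightarrow> tau_curve k a = \<tau> - 2"
    using sum_powers_pos[OF k a(1)] by (simp add: tau_curve_def P_def field_simps)
  finally show ?thesis .
qed

lemma tau_curve_pos: "k \<ge> 2 \<Longrightarrow> a > 0 \<Longrightarrow> tau_curve k a > 0"
  unfolding tau_curve_def by (intro divide_pos_pos sum_powers_pos add_pos_pos) auto

text \<open>The numerator of the derivative of \<^const>\<open>tau_curve\<close>; divided by \<open>a ^ (k - 1)\<close> it is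
  increasing, which is why the curve has a single turning point.\<close>

definition tau_curve_slope :: "nat \<Rightarrow> real \<Rightarrow> real" where
  "tau_curve_slope k a = (\<Sum>j\<in>{1..<k}. 2 * real (k - j) * a ^ (k + j - 1) - real j * a ^ (j - 1))"

lemma DERIV_tau_curve:
  assumes k: "k \<ge> 2" and a: "a > 0"
  shows "(tau_curve k has_real_derivative
    (tau_curve_slope k a / (\<Sum>j\<in>{1..<k}. a ^ j)\<^sup>2)) (at a)"
proof -
  define P where "P = (\<lambda>a. \<Sum>j\<in>{1..<k}. a ^ j :: real)"
  define P' where "P' = (\<Sum>j\<in>{1..<k}. real j * a ^ (j - 1))"
  have dP: "(P has_real_derivative P') (at a)"
    unfolding P_def P'_def by (auto intro!: derivative_eq_intros sum.cong)
  have dN: "((\<lambda>a. 2 * a ^ k + 1) has_real_derivative 2 * (real k * a ^ (k - 1))) (at a)"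
    by (auto intro!: derivative_eq_intros)
  \<comment> \<open>This is the numerator in the quotient rule. The power k + j - 1 arises twice,
    with coefficients 2 k and -2 j.\<close>
  have "2 * (real k * a ^ (k - 1)) * P a - (2 * a ^ k + 1) * P' =
     (\<Sum>j\<in>{1..<k}. 2 * (real k * a ^ (k - 1)) * a ^ j - (2 * a ^ k + 1) * (real j * a ^ (j - 1)))"
    by (simp add: P_def P'_def sum_distrib_left sum_subtractf)
  also have "\<dots> = tau_curve_slope k a"
    unfolding tau_curve_slope_def
  proof (rule sum.cong)
    fix j assume j: "j \<in> {1..<k}"
    have "a ^ (k - 1) * a ^ j = a ^ (k + j - 1)" "a ^ k * a ^ (j - 1) = a ^ (k + j - 1)"
      using j by (simp_all flip: power_add)
    thus "2 * (real k * a ^ (k - 1)) * a ^ j - (2 * a ^ k + 1) * (real j * a ^ (j - 1)) =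
        2 * real (k - j) * a ^ (k + j - 1) - real j * a ^ (j - 1)"
      using j by (simp add: of_nat_diff algebra_simps)
  qed simp
  finally have "2 * (real k * a ^ (k - 1)) * P a - (2 * a ^ k + 1) * P' = tau_curve_slope k a" .
  moreover have "P a \<noteq> 0" using sum_powers_pos[OF k a] by (simp add: P_def)
  ultimately have "((\<lambda>a. (2 * a ^ k + 1) / P a) has_real_derivative
      tau_curve_slope k a / (P a * P a)) (at a)"
    using DERIV_divide[OF dN dP] by simp
  thus ?thesis by (simp add: P_def tau_curve_def[abs_def] power2_eq_square)
qed

text \<open>After the division the j-th term is 2 (k - j) x^j - j / x^(k - j), and for 1 \<le> j < k
  both pieces increase with x.\<close>

lemma tau_curve_slope_scaled_less:
  assumes k: "k \<ge> 2" and a: "0 < a" and ab: "a < b"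
  shows "tau_curve_slope k a / a ^ (k - 1) < tau_curve_slope k b / b ^ (k - 1)"
proof -
  have eq: "tau_curve_slope k x / x ^ (k - 1) =
      (\<Sum>j\<in>{1..<k}. 2 * real (k - j) * x ^ j - real j / x ^ (k - j))" if "x > 0" for x
    unfolding tau_curve_slope_def sum_divide_distrib
  proof (rule sum.cong)
    fix j assume j: "j \<in> {1..<k}"
    have "x ^ (k + j - 1) = x ^ (k - 1) * x ^ j" "x ^ (k - 1) = x ^ (k - j) * x ^ (j - 1)"
      using j by (simp_all flip: power_add)
    thus "(2 * real (k - j) * x ^ (k + j - 1) - real j * x ^ (j - 1)) / x ^ (k - 1) =
        2 * real (k - j) * x ^ j - real j / x ^ (k - j)"
      using that by (simp add: diff_divide_distrib)
  qed simp
  show ?thesis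
    unfolding eq[OF a] eq[OF less_trans[OF a ab]]
  proof (rule sum_strict_mono)
    fix j assume j: "j \<in> {1..<k}"
    have "a ^ j < b ^ j" "a ^ (k - j) < b ^ (k - j)"
      using j a ab by (auto intro!: power_strict_mono)
    thus "2 * real (k - j) * a ^ j - real j / a ^ (k - j) < 2 * real (k - j) * b ^ j - real j / b ^ (k - j)"
      using j a ab by (intro diff_strict_mono) (auto intro!: divide_strict_left_mono mult_strict_left_mono)
  qed (use k in auto)
qed

text \<open>The slope is negative at 0 and positive at 1, hence vanishes at some c in between. Its
  scaled form is strictly increasing, so the sign changes only there, and the derivative has the
  same sign because its denominator is a positive square.\<close>

lemma tau_curve_turning_point:
  assumes k: "k \<ge> 2"
  obtains c where "0 < c" "c < 1"
    "\<And>x y. 0 < x \<Longrightarrow> x < y \<Longrightarrow> y \<le> c \<Longrightarrow> tau_curve k y < tau_curve k x"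
    "\<And>x y. c \<le> x \<Longrightarrow> x < y \<Longrightarrow> tau_curve k x < tau_curve k y"
proof -
  have "continuous_on {0..1} (tau_curve_slope k)"
    unfolding tau_curve_slope_def[abs_def] by (intro continuous_intros)
  moreover have s0: "tau_curve_slope k 0 < 0"
  proof -
    \<comment> \<open>At 0 all powers k + j - 1 vanish, and j 0^(j - 1) survives only for j =
      1.\<close>
    have "tau_curve_slope k 0 = (\<Sum>j\<in>{1..<k}. if j = 1 then - 1 else 0)"
      unfolding tau_curve_slope_def by (rule sum.cong) (auto simp: power_0_left)
    also have "\<dots> = - 1" using k by (subst sum.delta) auto
    finally show ?thesis by simp
  qed
  moreover have s1: "tau_curve_slope k 1 > 0"
  proof -
    \<comment> \<open>The reflection j -> k - j identifies the two sums, so the slope at 1 is twice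
      a positive sum minus that same sum.\<close>
    have "(\<Sum>j\<in>{1..<k}. real (k - j)) = (\<Sum>j\<in>{1..<k}. real j)"
      by (rule sum.reindex_bij_witness[of _ "\<lambda>j. k - j" "\<lambda>j. k - j"]) auto
    moreover have "tau_curve_slope k 1 = 2 * (\<Sum>j\<in>{1..<k}. real (k - j)) - (\<Sum>j\<in>{1..<k}. real j)"
      unfolding tau_curve_slope_def sum_subtractf sum_distrib_left by simp
    moreover have "(\<Sum>j\<in>{1..<k}. real j) > 0" using k by (intro sum_pos) auto
    ultimately show ?thesis by linarith
  qed
  ultimately have "\<exists>c\<ge>0. c \<le> 1 \<and> tau_curve_slope k c = 0"
    by (intro IVT') (simp_all add: less_imp_le)
  then obtain c where c: "0 \<le> c" "c \<le> 1" "tau_curve_slope k c = 0" by blast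
  have c01: "0 < c" "c < 1" using c s0 s1 by (auto simp: less_le)
  have neg: "tau_curve_slope k x < 0" if "0 < x" "x < c" for x
    using tau_curve_slope_scaled_less[OF k that] c that by (simp add: divide_less_0_iff)
  have pos: "tau_curve_slope k x > 0" if "c < x" for x
    using tau_curve_slope_scaled_less[OF k c01(1) that] c c01 that by (simp add: zero_less_divide_iff)
  have cont: "continuous_on {x..y} (tau_curve k)" if "0 < x" for x y
    using that by (intro DERIV_atLeastAtMost_imp_continuous_on) (meson DERIV_tau_curve k less_le_trans)
  have P2: "(\<Sum>j\<in>{1..<k}. x ^ j)\<^sup>2 > 0" if "0 < x" for x :: real
    using sum_powers_pos[OF k that] by simp
  show ?thesis
  proof (rule that[OF c01])
    fix x y :: real assume xy: "0 < x" "x < y" "y \<le> c"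
    show "tau_curve k y < tau_curve k x"
    proof (rule DERIV_neg_imp_decreasing_open[OF xy(2) _ cont[OF xy(1)]])
      fix z assume z: "x < z" "z < y"
      hence z0: "0 < z" "z < c" using xy by auto
      show "\<exists>D. (tau_curve k has_real_derivative D) (at z) \<and> D < 0"
        using DERIV_tau_curve[OF k z0(1)] divide_neg_pos[OF neg[OF z0] P2[OF z0(1)]] by blast
    qed
  next
    fix x y :: real assume xy: "c \<le> x" "x < y"
    hence x0: "0 < x" using c01 by simp
    show "tau_curve k x < tau_curve k y"
    proof (rule DERIV_pos_imp_increasing_open[OF xy(2) _ cont[OF x0]])
      fix z assume z: "x < z" "z < y"
      hence z0: "0 < z" "c < z" using xy x0 by auto
      show "\<exists>D. (tau_curve k has_real_derivative D) (at z) \<and> 0 < D"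
        using DERIV_tau_curve[OF k z0(1)] divide_pos_pos[OF pos[OF z0(2)] P2[OF z0(1)]] by blast
    qed
  qed
qed

text \<open>For a \<le> 1 each power in the denominator is at most a, and the numerator is at least
  1. Hence the curve tends to infinity at 0.\<close>

lemma tau_curve_ge_left:
  assumes k: "k \<ge> 2" and a: "0 < a" "a \<le> 1"
  shows "1 / (real k * a) \<le> tau_curve k a"
proof -
  have "(\<Sum>j\<in>{1..<k}. a ^ j) \<le> (\<Sum>j\<in>{1..<k}. a)"
    using a by (intro sum_mono power_decreasing[of 1, simplified]) auto
  also have "\<dots> \<le> real k * a" using a by simp
  finally have "1 / (real k * a) \<le> 1 / (\<Sum>j\<in>{1..<k}. a ^ j)"
    using sum_powers_pos[OF k a(1)] k a by (intro divide_left_mono) auto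
  also have "\<dots> \<le> tau_curve k a"
    using sum_powers_pos[OF k a(1)] a unfolding tau_curve_def by (intro divide_right_mono) auto
  finally show ?thesis .
qed

text \<open>For a \<ge> 1 each power in the denominator is at most a^(k-1), while the numerator
  exceeds a^k. Hence the curve is unbounded to the right.\<close>

lemma tau_curve_ge_right:
  assumes k: "k \<ge> 2" and a: "a \<ge> 1"
  shows "a / real k \<le> tau_curve k a"
proof -
  have P: "(\<Sum>j\<in>{1..<k}. a ^ j) > 0" using sum_powers_pos[OF k] a by simp
  have "(\<Sum>j\<in>{1..<k}. a ^ j) \<le> (\<Sum>j\<in>{1..<k}. a ^ (k - 1))"
    using a by (intro sum_mono power_increasing) auto
  also have "\<dots> \<le> real k * a ^ (k - 1)" using a by (simp add: mult_right_mono)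
  finally have "a * (\<Sum>j\<in>{1..<k}. a ^ j) \<le> a * (real k * a ^ (k - 1))"
    using a by (intro mult_left_mono) auto
  also have "\<dots> = real k * a ^ k" using k by (simp add: mult.left_commute flip: power_eq_if power_Suc)
  also have "\<dots> \<le> real k * (2 * a ^ k + 1)" using a by (intro mult_left_mono) auto
  finally show ?thesis unfolding tau_curve_def using P k by (simp add: field_simps)
qed

lemma tau_curve_level_sets:
  assumes k: "k \<ge> 2"
  obtains c where "0 < c" "c < 1" "tau_curve k c < tau_curve k 1"
    "\<And>t. t < tau_curve k c \<Longrightarrow> {a. 0 < a \<and> tau_curve k a = t} = {}"
    "{a. 0 < a \<and> tau_curve k a = tau_curve k c} = {c}"
    "\<And>t. t > tau_curve k c \<Longrightarrow> card {a. 0 < a \<and> tau_curve k a = t} = 2"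
proof -
  obtain c where c: "0 < c" "c < 1"
    and dec: "\<And>x y. 0 < x \<Longrightarrow> x < y \<Longrightarrow> y \<le> c \<Longrightarrow> tau_curve k y < tau_curve k x"
    and inc: "\<And>x y. c \<le> x \<Longrightarrow> x < y \<Longrightarrow> tau_curve k x < tau_curve k y"
    using tau_curve_turning_point[OF k] by blast
  have min: "tau_curve k c < tau_curve k a" if "0 < a" "a \<noteq> c" for a
    using dec[of a c] inc[of c a] that by (cases a c rule: linorder_cases) auto
  have cont: "continuous_on {0<..} (tau_curve k)"
    by (rule continuous_at_imp_continuous_on) (auto intro: DERIV_isCont DERIV_tau_curve[OF k])
  have left: "\<exists>x>0. x < c \<and> t < tau_curve k x" for t
  proof -
    \<comment> \<open>The first entry keeps x left of c; the second makes the lower bound 1 / (k x)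
      at least |t| + 1.\<close>
    define x where "x = min (c / 2) (1 / (real k * (\<bar>t\<bar> + 1)))"
    have x: "0 < x" "x < c" "x \<le> 1 / (real k * (\<bar>t\<bar> + 1))" using c k by (auto simp: x_def)
    have "t < \<bar>t\<bar> + 1" by simp
    also have "\<bar>t\<bar> + 1 \<le> 1 / (real k * x)"
    proof -
      have "x * (real k * (\<bar>t\<bar> + 1)) \<le> 1"
        using x(3) k by (simp add: pos_le_divide_eq del: distrib_left)
      thus ?thesis using x k by (simp add: pos_le_divide_eq mult_ac)
    qed
    also have "\<dots> \<le> tau_curve k x" using tau_curve_ge_left[OF k] x c by simp
    finally show ?thesis using x by blast
  qed
  have right: "\<exists>x>c. t < tau_curve k x" for t
  proof -
    \<comment> \<open>With this x the lower bound x / k equals |t| + 1, and x \<ge> 1 > c.\<close>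
    define x where "x = real k * (\<bar>t\<bar> + 1)"
    have x1: "x \<ge> 1" using k mult_mono[of 1 "real k" 1 "\<bar>t\<bar> + 1"] by (simp add: x_def)
    have "t < x / real k" using k by (simp add: x_def)
    also have "\<dots> \<le> tau_curve k x" using tau_curve_ge_right[OF k x1] .
    finally show ?thesis using x1 c by (intro exI[of _ x]) auto
  qed
  show ?thesis
  proof (rule that[OF c])
    show "tau_curve k c < tau_curve k 1" using min[of 1] c by simp
    show "{a. 0 < a \<and> tau_curve k a = t} = {}" if "t < tau_curve k c" for t
      using min that by fastforce
    show "{a. 0 < a \<and> tau_curve k a = tau_curve k c} = {c}"
      using min c by fastforce
    show "card {a. 0 < a \<and> tau_curve k a = t} = 2" if "t > tau_curve k c" for t
      by (rule card_two_sided_level_set[OF c(1) cont dec inc left right that])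
  qed
qed

section \<open>Measures on the tree\<close>

definition step_rel :: "'v set set \<Rightarrow> 'v set \<Rightarrow> ('v \<times> 'v) set" where
  "step_rel L A = {(u, v). u \<in> A \<and> v \<in> A \<and> {u, v} \<in> L}"

text \<open>Reachability composes freely, whereas \<open>is_path\<close> demands distinct vertices.
  A walk is turned into a path as it grows: a new vertex is appended, and a return to a visited
  vertex cuts the path back to it.\<close>

lemma is_path_of_rtrancl:
  assumes "(x, y) \<in> (step_rel L A)\<^sup>*" and "x \<in> A"
  shows "\<exists>p. is_path L x p y \<and> set p \<subseteq> A"
  using assms(1)
proof (induction rule: rtrancl_induct)
  case base
  have "is_path L x [x] x" by (simp add: is_path_def)
  thus ?case using assms(2) by force
next
  case (step y z)
  then obtain p where p: "is_path L x p y" "set p \<subseteq> A" by blast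
  show ?case
  proof (cases "z \<in> set p")
    case True
    then obtain p1 p2 where s: "p = p1 @ z # p2" by (auto simp: in_set_conv_decomp)
    have "is_path L x (p1 @ [z]) z"
      using p(1) successively_append_iff[of "\<lambda>u v. {u, v} \<in> L" "p1 @ [z]" p2]
      unfolding s is_path_def by (cases p1) auto
    thus ?thesis using p(2) s by (intro exI[of _ "p1 @ [z]"]) auto
  next
    case False
    have "is_path L x (p @ [z]) z"
      using p(1) step.hyps False unfolding is_path_def step_rel_def
      by (auto simp: successively_append_iff)
    thus ?thesis using p(2) step.hyps by (intro exI[of _ "p @ [z]"]) (auto simp: step_rel_def)
  qed
qed

lemma rtrancl_of_successively:
  assumes "successively (\<lambda>u v. {u, v} \<in> L) p" and "set p \<subseteq> A" and "v \<in> set p"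
  shows "(hd p, v) \<in> (step_rel L A)\<^sup>*"
  using assms
proof (induction p rule: induct_list012)
  case (3 x y zs)
  have xy: "(x, y) \<in> step_rel L A" using 3 by (auto simp: step_rel_def)
  show ?case
  proof (cases "v = x")
    case False
    hence "(y, v) \<in> (step_rel L A)\<^sup>*" using 3 by auto
    thus ?thesis using xy by (auto intro: converse_rtrancl_into_rtrancl)
  qed simp
qed auto

lemma connected_in_if_reachable:
  assumes "\<And>v. v \<in> A \<Longrightarrow> (r, v) \<in> (step_rel L A)\<^sup>*"
  shows "connected_in L A"
  unfolding connected_in_def
proof (intro ballI)
  fix x y assume xy: "x \<in> A" "y \<in> A"
  have "sym (step_rel L A)" by (auto simp: sym_def step_rel_def insert_commute)
  hence "(x, r) \<in> (step_rel L A)\<^sup>*"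
    using assms[OF xy(1)] sym_rtrancl by (metis symD)
  hence "(x, y) \<in> (step_rel L A)\<^sup>*" using assms[OF xy(2)] by (rule rtrancl_trans)
  thus "\<exists>p. is_path L x p y \<and> set p \<subseteq> A" using xy(1) by (rule is_path_of_rtrancl)
qed

text \<open>The union of paths from r to the points of J, together with r, works: every vertex on
  such a path is reached from r along an initial piece inside the union.\<close>

lemma finite_connected_superset:
  assumes V: "connected_in L V" and r: "r \<in> V" and J: "finite J" "J \<subseteq> V"
  obtains \<Lambda> where "finite \<Lambda>" "r \<in> \<Lambda>" "J \<subseteq> \<Lambda>" "\<Lambda> \<subseteq> V" "connected_in L \<Lambda>"
proof -
  have "\<forall>v\<in>V. \<exists>p. is_path L r p v \<and> set p \<subseteq> V" using V r by (auto simp: connected_in_def)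
  then obtain p where p: "\<And>v. v \<in> V \<Longrightarrow> is_path L r (p v) v" "\<And>v. v \<in> V \<Longrightarrow> set (p v) \<subseteq> V"
    by metis
  define \<Lambda> where "\<Lambda> = (\<Union>v\<in>insert r J. set (p v))"
  have last: "v \<in> set (p v)" if "v \<in> V" for v
    using p(1)[OF that] by (metis is_path_def last_in_set)
  show ?thesis
  proof (rule that)
    show "finite \<Lambda>" using J by (simp add: \<Lambda>_def)
    show "r \<in> \<Lambda>" "J \<subseteq> \<Lambda>" using last r J by (auto simp: \<Lambda>_def)
    show "\<Lambda> \<subseteq> V" using p(2) r J by (auto simp: \<Lambda>_def)
    show "connected_in L \<Lambda>"
    proof (rule connected_in_if_reachable)
      fix v assume "v \<in> \<Lambda>"
      then obtain u where u: "u \<in> insert r J" "v \<in> set (p u)" by (auto simp: \<Lambda>_def)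
      have "is_path L r (p u) u" using u(1) r J p(1) by auto
      thus "(r, v) \<in> (step_rel L \<Lambda>)\<^sup>*"
        using rtrancl_of_successively[of L "p u" \<Lambda> v] u by (auto simp: is_path_def \<Lambda>_def)
    qed
  qed
qed

section \<open>Local structure of the tree\<close>

lemma cayley_tree_edge:
  assumes "cayley_tree k V L" and "{x, y} \<in> L"
  shows "x \<in> V" "y \<in> V" "x \<noteq> y"
proof -
  obtain u v where "u \<in> V" "v \<in> V" "u \<noteq> v" "{x, y} = {u, v}"
    using assms unfolding cayley_tree_def by meson
  thus "x \<in> V" "y \<in> V" "x \<noteq> y" by (auto simp: doubleton_eq_iff)
qed

lemma finite_outer_boundary:
  assumes T: "cayley_tree k V L" and "finite \<Lambda>" "\<Lambda> \<subseteq> V"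
  shows "finite (outer_boundary V L \<Lambda>)"
proof (rule finite_subset)
  show "outer_boundary V L \<Lambda> \<subseteq> (\<Union>x\<in>\<Lambda>. {y \<in> V. {x, y} \<in> L})"
    by (auto simp: outer_boundary_def)
  \<comment> \<open>\<open>card\<close> is 0 on infinite sets, so the degree k + 1 forces finitely
    many neighbours.\<close>
  have "finite {y \<in> V. {x, y} \<in> L}" if "x \<in> \<Lambda>" for x
    using T that assms(3) unfolding cayley_tree_def by (intro card_ge_0_finite) auto
  thus "finite (\<Union>x\<in>\<Lambda>. {y \<in> V. {x, y} \<in> L})" using assms(2) by blast
qed

lemma oriented_edges_subset:
  assumes "cayley_tree k V L"
  shows "oriented_edges L r \<subseteq> V \<times> V"
  using cayley_tree_edge[OF assms] by (auto simp: oriented_edges_def)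

lemma tree_path_refl: "tree_path L x x = [x]"
  unfolding tree_path_def
proof (rule the_equality)
  show "is_path L x [x] x" by (simp add: is_path_def)
  fix p assume "is_path L x p x"
  thus "p = [x]" unfolding is_path_def
    by (cases p) (auto split: if_splits)
qed

text \<open>A path from x to y with at least three vertices would be closed to a cycle by the edge
  itself.\<close>

lemma tree_path_edge:
  assumes T: "cayley_tree k V L" and xy: "{x, y} \<in> L"
  shows "tree_path L x y = [x, y]"
  unfolding tree_path_def
proof (rule the_equality)
  have ne: "x \<noteq> y" using cayley_tree_edge[OF T xy] by simp
  show "is_path L x [x, y] y" using xy ne by (simp add: is_path_def)
  fix p assume p: "is_path L x p y"
  show "p = [x, y]"
  proof (cases "3 \<le> length p")
    case True
    hence "is_cycle L p" using p xy by (simp add: is_path_def is_cycle_def insert_commute)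
    thus ?thesis using T by (auto simp: cayley_tree_def)
  next
    case False
    hence "length p = 0 \<or> length p = 1 \<or> length p = 2" by linarith
    thus ?thesis using p ne by (auto simp: is_path_def length_Suc_conv numeral_2_eq_2)
  qed
qed

lemma root_edge_oriented:
  assumes "cayley_tree k V L" and "{r, y} \<in> L"
  shows "(r, y) \<in> oriented_edges L r"
  using assms by (simp add: oriented_edges_def tree_dist_def tree_path_edge tree_path_refl)

text \<open>Edges at the root point away from it, so no sign appears and the increments to the
  neighbours are free coordinates.\<close>

lemma path_increment_root_edge:
  assumes "cayley_tree k V L" and "{r, y} \<in> L"
  shows "path_increment L (oriented_edges L r) \<zeta> r y = \<zeta> (r, y)"
  using assms
  by (simp add: path_increment_def tree_path_edge root_edge_oriented edge_increment_def)

lemma sos_Q_pos: "sos_Q \<beta> m > 0"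
  by (simp add: sos_Q_def)

section \<open>Marginals of associated measures\<close>

lemma associated_measure_marginal:
  assumes "associated_measure V L r \<beta> q l \<nu>" and "finite \<Lambda>" "w \<in> \<Lambda>" "\<Lambda> \<subseteq> V" "connected_in L \<Lambda>"
  defines "D \<equiv> oriented_edges L r"
  shows "\<exists>Z>0. \<forall>\<zeta>\<in>space (grad_space D).
    measure \<nu> {\<eta> \<in> space (grad_space D). \<forall>b\<in>edges_inside D (\<Lambda> \<union> outer_boundary V L \<Lambda>). \<eta> b = \<zeta> b} =
    Z * (\<Sum>s<q. \<Prod>y\<in>outer_boundary V L \<Lambda>. l (int s + path_increment L D \<zeta> w y)) *
    (\<Prod>b\<in>edges_touching D \<Lambda>. sos_Q \<beta> (\<zeta> b))"
proof -
  have "finite \<Lambda> \<and> \<Lambda> \<noteq> {} \<and> \<Lambda> \<subseteq> V \<and> connected_in L \<Lambda>" using assms(2-5) by auto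
  from assms(1)[unfolded associated_measure_def Let_def D_def[symmetric],
      THEN conjunct2, THEN conjunct2, THEN spec, THEN mp, OF this]
  show ?thesis using assms(3) by meson
qed

text \<open>Taking the single vertex r as the finite set, both laws describe the same cylinder
  probabilities. The edge weight is common to both and positive, so it cancels, and the two
  boundary-law sums are proportional.\<close>

lemma associated_measure_single_vertex:
  assumes T: "cayley_tree k V L" and r: "r \<in> V"
    and 1: "associated_measure V L r \<beta> q l \<nu>" and 2: "associated_measure V L r \<beta> q' l' \<nu>"
  defines "N \<equiv> {y \<in> V. {r, y} \<in> L}"
  shows "\<exists>c>0. \<forall>g. (\<Sum>s<q'. \<Prod>y\<in>N. l' (int s + g y)) = c * (\<Sum>s<q. \<Prod>y\<in>N. l (int s + g y))"
proof -
  define D where "D = oriented_edges L r"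
  have bd: "outer_boundary V L {r} = N"
    using cayley_tree_edge(3)[OF T, of r r] by (auto simp: N_def outer_boundary_def)
  have conn: "connected_in L {r}"
    by (auto simp: connected_in_def is_path_def intro!: exI[of _ "[r]"])
  define C where "C \<zeta> = {\<eta> \<in> space (grad_space D). \<forall>b\<in>edges_inside D ({r} \<union> N). \<eta> b = \<zeta> b}" for \<zeta>
  define W where "W \<zeta> = (\<Prod>b\<in>edges_touching D {r}. sos_Q \<beta> (\<zeta> b))" for \<zeta>
  have W: "W \<zeta> > 0" for \<zeta> unfolding W_def by (intro prod_pos) (simp add: sos_Q_pos)
  have form: "\<exists>Z>0. \<forall>\<zeta>\<in>space (grad_space D).
      measure \<nu> (C \<zeta>) = Z * (\<Sum>s<q. \<Prod>y\<in>N. l (int s + \<zeta> (r, y))) * W \<zeta>"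
    if "associated_measure V L r \<beta> q l \<nu>" for q l
  proof -
    have eq: "(\<Prod>y\<in>N. l (int s + path_increment L D \<zeta> r y)) = (\<Prod>y\<in>N. l (int s + \<zeta> (r, y)))" for s \<zeta>
      unfolding D_def
      by (rule prod.cong) (auto simp: N_def path_increment_root_edge[OF T])
    have "finite {r}" "r \<in> {r}" "{r} \<subseteq> V" using r by auto
    from associated_measure_marginal[OF that this conn, folded D_def]
    show ?thesis unfolding bd C_def[symmetric] W_def[symmetric] by (simp add: eq)
  qed
  obtain Z where Z: "Z > 0" "\<And>\<zeta>. \<zeta> \<in> space (grad_space D) \<Longrightarrow>
      measure \<nu> (C \<zeta>) = Z * (\<Sum>s<q. \<Prod>y\<in>N. l (int s + \<zeta> (r, y))) * W \<zeta>"
    using form[OF 1] by blast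
  obtain Z' where Z': "Z' > 0" "\<And>\<zeta>. \<zeta> \<in> space (grad_space D) \<Longrightarrow>
      measure \<nu> (C \<zeta>) = Z' * (\<Sum>s<q'. \<Prod>y\<in>N. l' (int s + \<zeta> (r, y))) * W \<zeta>"
    using form[OF 2] by blast
  have "(\<Sum>s<q'. \<Prod>y\<in>N. l' (int s + g y)) = (Z / Z') * (\<Sum>s<q. \<Prod>y\<in>N. l (int s + g y))" for g
  proof -
    \<comment> \<open>The edge from r to y carries \<open>g y\<close>, so any prescribed increments
      come from a configuration.\<close>
    define \<zeta> where "\<zeta> = (\<lambda>b\<in>D. g (snd b))"
    have "\<zeta> \<in> space (grad_space D)" by (simp add: \<zeta>_def grad_space_def space_PiM)
    from Z(2)[OF this] Z'(2)[OF this] W[of \<zeta>]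
    have "Z * (\<Sum>s<q. \<Prod>y\<in>N. l (int s + \<zeta> (r, y))) = Z' * (\<Sum>s<q'. \<Prod>y\<in>N. l' (int s + \<zeta> (r, y)))"
      by simp
    moreover have "(\<Prod>y\<in>N. f (int s + \<zeta> (r, y))) = (\<Prod>y\<in>N. f (int s + g y))" for s and f :: "int \<Rightarrow> real"
      by (rule prod.cong) (auto simp: N_def \<zeta>_def D_def root_edge_oriented[OF T])
    ultimately show ?thesis using Z'(1) by (simp add: field_simps)
  qed
  thus ?thesis using Z(1) Z'(1) by (intro exI[of _ "Z / Z'"]) auto
qed

text \<open>On the cylinders over the edges in and around a finite connected set, the two measures
  differ by the constant factor Z / Z'. These cylinders form a countable partition, so total mass 1
  makes the factor 1. Every event on finitely many edges is a union of such cylinders for a large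
  enough set, and these events determine the measure.\<close>

lemma associated_measure_unique:
  assumes T: "cayley_tree k V L" and r: "r \<in> V"
    and 1: "associated_measure V L r \<beta> q l \<nu>" and 2: "associated_measure V L r \<beta> q l \<nu>'"
  shows "\<nu> = \<nu>'"
proof -
  define D where "D = oriented_edges L r"
  define P where "P = (\<Pi>\<^sub>M b\<in>D. count_space (UNIV :: int set))"
  have gP: "grad_space D = P" by (simp add: grad_space_def P_def)
  have spP: "space P = D \<rightarrow>\<^sub>E UNIV" by (simp add: P_def space_PiM)
  have pr: "prob_space \<nu>" "prob_space \<nu>'" and s: "sets \<nu> = sets P" "sets \<nu>' = sets P"
    using 1 2 unfolding associated_measure_def Let_def D_def[symmetric] gP by auto
  interpret \<nu>: prob_space \<nu> by fact
  interpret \<nu>': prob_space \<nu>' by fact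
  show ?thesis
  proof (rule measure_eqI_PiM_infinite[OF s[unfolded P_def]])
    fix A :: "'a \<times> 'a \<Rightarrow> int set" and J assume J: "finite J" "J \<subseteq> D"
    have DV: "D \<subseteq> V \<times> V" unfolding D_def by (rule oriented_edges_subset[OF T])
    \<comment> \<open>The density formula speaks only of connected sets, so the endpoints of the
      given edges are enlarged to one.\<close>
    have "finite (fst ` J \<union> snd ` J)" "fst ` J \<union> snd ` J \<subseteq> V" using J DV by auto
    moreover have "connected_in L V" using T by (simp add: cayley_tree_def)
    ultimately obtain \<Lambda> where \<Lambda>: "finite \<Lambda>" "r \<in> \<Lambda>" "fst ` J \<union> snd ` J \<subseteq> \<Lambda>" "\<Lambda> \<subseteq> V" "connected_in L \<Lambda>"
      using finite_connected_superset r by metis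
    define E where "E = edges_inside D (\<Lambda> \<union> outer_boundary V L \<Lambda>)"
    have "E \<subseteq> (\<Lambda> \<union> outer_boundary V L \<Lambda>) \<times> (\<Lambda> \<union> outer_boundary V L \<Lambda>)"
      by (auto simp: E_def edges_inside_def)
    hence finE: "finite E"
      using \<Lambda> finite_outer_boundary[OF T \<Lambda>(1,4)] by (meson finite_SigmaI finite_UnI finite_subset)
    have ED: "E \<subseteq> D" by (auto simp: E_def edges_inside_def)
    have JE: "J \<subseteq> E" using \<Lambda>(3) J(2) by (force simp: E_def edges_inside_def)
    define C where "C \<zeta> = {\<eta> \<in> space P. \<forall>b\<in>E. \<eta> b = \<zeta> b}" for \<zeta> :: "'a \<times> 'a \<Rightarrow> int"
    have C_sets: "C \<zeta> \<in> sets P" for \<zeta>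
    proof -
      have "{\<eta> \<in> space P. \<eta> b = \<zeta> b} \<in> sets P" if "b \<in> E" for b
      proof -
        have "(\<lambda>\<eta>. \<eta> b) \<in> measurable P (count_space UNIV)"
          unfolding P_def using that ED by (intro measurable_component_singleton) auto
        from measurable_sets[OF this, of "{\<zeta> b}"] show ?thesis by (simp add: vimage_def Int_def conj_commute)
      qed
      thus ?thesis unfolding C_def by (intro sets.sets_Collect_finite_All finE) auto
    qed
    define I where "I = (E \<rightarrow>\<^sub>E (UNIV :: int set))"
    have cI: "countable I" unfolding I_def using finE by (intro countable_PiE) auto
    have disj: "disjoint_family_on C F" if "F \<subseteq> I" for F
      unfolding disjoint_family_on_def
    proof (intro ballI impI)
      fix f g assume fg: "f \<in> F" "g \<in> F" "f \<noteq> g"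
      hence "\<exists>b\<in>E. f b \<noteq> g b" using that unfolding I_def by (meson PiE_ext subsetD)
      thus "C f \<inter> C g = {}" by (auto simp: C_def)
    qed
    \<comment> \<open>An event that depends only on the edges in \<open>E\<close> is a union of
      cylinders; the constantly true predicate gives the whole space.\<close>
    have UnC: "(\<Union>f\<in>{f\<in>I. Q f}. C f) = {\<eta> \<in> space P. Q (restrict \<eta> E)}" for Q
    proof (intro equalityI subsetI)
      fix \<eta> assume "\<eta> \<in> (\<Union>f\<in>{f\<in>I. Q f}. C f)"
      then obtain f where f: "f \<in> I" "Q f" "\<eta> \<in> space P" "\<forall>b\<in>E. \<eta> b = f b" by (auto simp: C_def)
      have "restrict \<eta> E = f"
        using f(1,4) unfolding I_def
        by (intro PiE_ext[where k = E and s = "\<lambda>_. UNIV"]) auto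
      thus "\<eta> \<in> {\<eta> \<in> space P. Q (restrict \<eta> E)}" using f by auto
    next
      fix \<eta> assume "\<eta> \<in> {\<eta> \<in> space P. Q (restrict \<eta> E)}"
      thus "\<eta> \<in> (\<Union>f\<in>{f\<in>I. Q f}. C f)"
        by (auto simp: C_def I_def intro!: bexI[of _ "restrict \<eta> E"] exI[of _ "restrict \<eta> E"])
    qed
    have form: "\<exists>Z>0. \<forall>\<zeta>\<in>space P. measure \<mu> (C \<zeta>) =
        Z * (\<Sum>s<q. \<Prod>y\<in>outer_boundary V L \<Lambda>. l (int s + path_increment L D \<zeta> r y)) *
        (\<Prod>b\<in>edges_touching D \<Lambda>. sos_Q \<beta> (\<zeta> b))"
      if "associated_measure V L r \<beta> q l \<mu>" for \<mu>
      using associated_measure_marginal[OF that \<Lambda>(1,2,4,5), folded D_def]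
      unfolding gP C_def E_def .
    obtain Z where Z: "Z > 0" "\<And>\<zeta>. \<zeta> \<in> space P \<Longrightarrow> measure \<nu> (C \<zeta>) =
        Z * (\<Sum>s<q. \<Prod>y\<in>outer_boundary V L \<Lambda>. l (int s + path_increment L D \<zeta> r y)) *
        (\<Prod>b\<in>edges_touching D \<Lambda>. sos_Q \<beta> (\<zeta> b))"
      using form[OF 1] by blast
    obtain Z' where Z': "Z' > 0" "\<And>\<zeta>. \<zeta> \<in> space P \<Longrightarrow> measure \<nu>' (C \<zeta>) =
        Z' * (\<Sum>s<q. \<Prod>y\<in>outer_boundary V L \<Lambda>. l (int s + path_increment L D \<zeta> r y)) *
        (\<Prod>b\<in>edges_touching D \<Lambda>. sos_Q \<beta> (\<zeta> b))"
      using form[OF 2] by blast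
    define c where "c = Z / Z'"
    have c: "c > 0" using Z Z' by (simp add: c_def)
    have Cc: "emeasure \<nu> (C f) = ennreal c * emeasure \<nu>' (C f)" for f
    proof -
      \<comment> \<open>Restricting \<open>f\<close> to \<open>D\<close> makes it a configuration
        and keeps its cylinder, because \<open>E\<close> lies in \<open>D\<close>.\<close>
      define \<zeta> where "\<zeta> = (\<lambda>b\<in>D. f b)"
      have "C f = C \<zeta>" using ED by (auto simp: C_def \<zeta>_def)
      moreover have "\<zeta> \<in> space P" by (simp add: spP \<zeta>_def)
      ultimately have "measure \<nu> (C f) = c * measure \<nu>' (C f)"
        using Z Z' by (simp add: c_def)
      thus ?thesis
        using c by (simp add: \<nu>.emeasure_eq_measure \<nu>'.emeasure_eq_measure ennreal_mult')
    qed
    have Uc: "emeasure \<nu> (\<Union>f\<in>F. C f) = ennreal c * emeasure \<nu>' (\<Union>f\<in>F. C f)" if "F \<subseteq> I" for F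
    proof -
      have cF: "countable F" using cI that by (rule countable_subset[rotated])
      have "emeasure \<nu> (\<Union>f\<in>F. C f) = (\<integral>\<^sup>+f. ennreal c * emeasure \<nu>' (C f) \<partial>count_space F)"
        using C_sets s cF disj[OF that] by (simp add: emeasure_UN_countable flip: Cc)
      also have "\<dots> = ennreal c * (\<integral>\<^sup>+f. emeasure \<nu>' (C f) \<partial>count_space F)"
        by (rule nn_integral_cmult) simp
      also have "(\<integral>\<^sup>+f. emeasure \<nu>' (C f) \<partial>count_space F) = emeasure \<nu>' (\<Union>f\<in>F. C f)"
        using C_sets s cF disj[OF that] by (simp add: emeasure_UN_countable)
      finally show ?thesis .
    qed
    have "space \<nu> = space P" "space \<nu>' = space P" using s by (auto dest: sets_eq_imp_space_eq)
    hence "1 = ennreal c * 1"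
      using Uc[of "{f \<in> I. True}"] UnC[of "\<lambda>_. True"] \<nu>.emeasure_space_1 \<nu>'.emeasure_space_1 by simp
    hence c1: "ennreal c = 1" by simp
    have "prod_emb D (\<lambda>_. count_space UNIV) J (Pi\<^sub>E J A) = {\<eta> \<in> space P. \<forall>b\<in>J. \<eta> b \<in> A b}"
      by (auto simp: prod_emb_iff spP PiE_iff)
    also have "\<dots> = {\<eta> \<in> space P. \<forall>b\<in>J. restrict \<eta> E b \<in> A b}"
      using JE by (intro Collect_cong conj_cong ball_cong) auto
    also have "\<dots> = (\<Union>f\<in>{f\<in>I. \<forall>b\<in>J. f b \<in> A b}. C f)" by (rule UnC[symmetric])
    finally have "prod_emb D (\<lambda>_. count_space UNIV) J (Pi\<^sub>E J A) = (\<Union>f\<in>{f\<in>I. \<forall>b\<in>J. f b \<in> A b}. C f)" .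
    thus "emeasure \<nu> (prod_emb D (\<lambda>_. count_space UNIV) J (Pi\<^sub>E J A)) =
        emeasure \<nu>' (prod_emb D (\<lambda>_. count_space UNIV) J (Pi\<^sub>E J A))"
      using Uc[of "{f\<in>I. \<forall>b\<in>J. f b \<in> A b}"] c1 by auto
  qed (rule \<nu>.finite_measure_axioms)
qed

section \<open>Three-periodic and four-periodic laws\<close>

text \<open>The remaining k - 1 neighbours have increment 0, whence the power.\<close>

lemma prod_law_two_sites:
  fixes l :: "int \<Rightarrow> real"
  assumes "finite N" "card N = k + 1" "y1 \<in> N" "y2 \<in> N" "y1 \<noteq> y2"
  shows "(\<Prod>y\<in>N. l (s + ((\<lambda>_. 0)(y1 := u, y2 := v)) y)) = l (s + u) * l (s + v) * l s ^ (k - 1)"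
proof -
  define R where "R = N - {y1, y2}"
  have N: "N = insert y1 (insert y2 R)" using assms by (auto simp: R_def)
  have R: "finite R" "y1 \<notin> R" "y2 \<notin> R" "card R = k - 1"
    using assms by (auto simp: R_def card_Diff_subset)
  have "(\<Prod>y\<in>R. l (s + ((\<lambda>_. 0)(y1 := u, y2 := v)) y)) = (\<Prod>y\<in>R. l s)"
    using R by (intro prod.cong) auto
  thus ?thesis using R assms(5) unfolding N by (simp add: mult.assoc)
qed

text \<open>Varying the increments at just two neighbours of r gives enough values to tell the laws
  below apart.\<close>

lemma associated_measure_two_sites:
  assumes T: "cayley_tree k V L" and k: "k \<ge> 2" and r: "r \<in> V"
    and 1: "associated_measure V L r \<beta> q l \<nu>" and 2: "associated_measure V L r \<beta> q' l' \<nu>"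
  shows "\<exists>c>0. \<forall>u v. (\<Sum>s<q'. l' (int s + u) * l' (int s + v) * l' (int s) ^ (k - 1)) =
    c * (\<Sum>s<q. l (int s + u) * l (int s + v) * l (int s) ^ (k - 1))"
proof -
  define N where "N = {y \<in> V. {r, y} \<in> L}"
  have cN: "card N = k + 1" using T r by (simp add: N_def cayley_tree_def)
  hence fin: "finite N" by (intro card_ge_0_finite) simp
  have "\<not> card N \<le> Suc 0" using cN k by simp
  then obtain y1 y2 where y: "y1 \<in> N" "y2 \<in> N" "y1 \<noteq> y2"
    unfolding card_le_Suc0_iff_eq[OF fin] by blast
  obtain c where c: "c > 0" "\<And>g. (\<Sum>s<q'. \<Prod>y\<in>N. l' (int s + g y)) = c * (\<Sum>s<q. \<Prod>y\<in>N. l (int s + g y))"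
    using associated_measure_single_vertex[OF T r 1 2] unfolding N_def by blast
  show ?thesis
    using c(1) c(2)[of "(\<lambda>_. 0)(y1 := u, y2 := v)" for u v]
    unfolding prod_law_two_sites[OF fin cN y] by blast
qed

text \<open>The law takes the values 1, x, x over a period, so F 0 0 = 1 + 2 x^(k+1), F 1 0 = x +
  x^k + x^(k+1) and F 1 2 = x^2 + 2 x^k. The two differences share the factor 1 - x, which leaves
  their quotient. The last equation is the period 3 in the first increment.\<close>

lemma three_law_two_sites:
  fixes a :: real
  assumes k: "k \<ge> 2"
  defines "x \<equiv> a ^ k"
  defines "F \<equiv> \<lambda>u v. \<Sum>s<3. three_law k a (int s + u) * three_law k a (int s + v) * three_law k a (int s) ^ (k - 1)"
  shows "F 0 0 - F 1 0 = (1 - x) * (1 - x ^ k)"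
    and "F 1 0 - F 1 2 = (1 - x) * (x * (1 - x ^ (k - 1)))"
    and "F 4 0 = F 1 0"
proof -
  have xk: "x ^ k = x * x ^ (k - 1)" using k by (cases k) auto
  show "F 0 0 - F 1 0 = (1 - x) * (1 - x ^ k)" "F 1 0 - F 1 2 = (1 - x) * (x * (1 - x ^ (k - 1)))"
    "F 4 0 = F 1 0"
    by (simp_all add: F_def three_law_def numeral_3_eq_3 x_def[symmetric] xk algebra_simps)
qed

lemma three_law_measure_inj:
  assumes T: "cayley_tree k V L" and k: "k \<ge> 2" and r: "r \<in> V"
    and a: "a > 0" "a \<noteq> 1" and b: "b > 0" "b \<noteq> 1"
    and 1: "associated_measure V L r \<beta> 3 (three_law k a) \<nu>"
    and 2: "associated_measure V L r \<beta> 3 (three_law k b) \<nu>"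
  shows "a = b"
proof -
  define x where "x = a ^ k"
  define y where "y = b ^ k"
  have x: "x > 0" "x \<noteq> 1" using a k power_eq_iff_eq_base[of k a 1] by (auto simp: x_def)
  have y: "y > 0" "y \<noteq> 1" using b k power_eq_iff_eq_base[of k b 1] by (auto simp: y_def)
  define F where "F a u v = (\<Sum>s<3. three_law k a (int s + u) * three_law k a (int s + v) * three_law k a (int s) ^ (k - 1))"
    for a u v
  obtain c where c: "c > 0" "\<And>u v. F b u v = c * F a u v"
    using associated_measure_two_sites[OF T k r 1 2] unfolding F_def by blast
  \<comment> \<open>The quotients of differences are compared cross-multiplied, without dividing; c
    enters both sides to the first power.\<close>
  have "(F b 0 0 - F b 1 0) * (F a 1 0 - F a 1 2) = (F a 0 0 - F a 1 0) * (F b 1 0 - F b 1 2)"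
    unfolding c(2) by (simp add: algebra_simps)
  hence "((1 - y) * (1 - y ^ k)) * ((1 - x) * (x * (1 - x ^ (k - 1)))) =
      ((1 - x) * (1 - x ^ k)) * ((1 - y) * (y * (1 - y ^ (k - 1))))"
    unfolding F_def three_law_two_sites[OF k] x_def y_def .
  hence eq: "(1 - y ^ k) * (x * (1 - x ^ (k - 1))) = (1 - x ^ k) * (y * (1 - y ^ (k - 1)))"
    using x(2) y(2) by simp
  \<comment> \<open>\<open>p z\<close> is z + ... + z^(k-1). With 1 - z removed, the quotient of
    differences is (1 + p z) / p z, and \<open>p\<close> is strictly increasing on the positive
    reals.\<close>
  define p where "p z = z * (\<Sum>j<k - 1. z ^ j)" for z :: real
  have g1: "z * (1 - z ^ (k - 1)) = (1 - z) * p z" for z :: real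
    by (simp add: p_def one_diff_power_eq mult.left_commute)
  have g2: "1 - z ^ k = (1 - z) * (1 + p z)" for z :: real
  proof -
    have "z ^ k = z * z ^ (k - 1)" using k by (cases k) auto
    thus ?thesis using g1[of z] by (simp add: algebra_simps)
  qed
  have "((1 - x) * (1 - y)) * ((1 + p y) * p x) = ((1 - x) * (1 - y)) * ((1 + p x) * p y)"
    using eq unfolding g1 g2 by (simp add: mult_ac)
  hence "(1 + p y) * p x = (1 + p x) * p y" using x(2) y(2) by simp
  hence "p x = p y" by (simp add: algebra_simps)
  moreover have "p u < p v" if "0 < u" "u < v" for u v
  proof -
    have pos: "(\<Sum>j<k - 1. u ^ j) > 0"
      using that k by (intro sum_pos) (auto simp: lessThan_empty_iff)
    have "(\<Sum>j<k - 1. u ^ j) \<le> (\<Sum>j<k - 1. v ^ j)"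
      using that by (intro sum_mono power_mono) auto
    thus ?thesis unfolding p_def using that pos by (intro mult_less_le_imp_less) auto
  qed
  ultimately have "x = y" using x y by (metis linorder_neqE less_irrefl)
  thus "a = b" using a b k unfolding x_def y_def by (simp add: power_eq_iff_eq_base)
qed

text \<open>In the first increment G has period 4 and F has period 3, so proportionality gives F 1 0
  = F 4 0 = F 0 0. Yet F 0 0 - F 1 0 = (1 - x)(1 - x^k) is nonzero for positive x other than
  1.\<close>

lemma three_law_measure_neq_four_law_measure:
  assumes T: "cayley_tree k V L" and k: "k \<ge> 2" and r: "r \<in> V" and a: "a > 0" "a \<noteq> 1"
    and 1: "associated_measure V L r \<beta> 3 (three_law k a) \<nu>"
    and 2: "associated_measure V L r \<beta> 4 l \<nu>" and l: "periodic_law 4 l"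
  shows False
proof -
  define x where "x = a ^ k"
  have x: "x > 0" "x \<noteq> 1" using a k power_eq_iff_eq_base[of k a 1] by (auto simp: x_def)
  have xk: "x ^ k \<noteq> 1" using x k power_eq_iff_eq_base[of k x 1] by auto
  define F where "F u v = (\<Sum>s<3. three_law k a (int s + u) * three_law k a (int s + v) * three_law k a (int s) ^ (k - 1))"
    for u v
  define G where "G u v = (\<Sum>s<4. l (int s + u) * l (int s + v) * l (int s) ^ (k - 1))" for u v
  obtain c where c: "c > 0" "\<And>u v. G u v = c * F u v"
    using associated_measure_two_sites[OF T k r 1 2] unfolding F_def G_def by blast
  have "G 4 0 = G 0 0" using l by (simp add: G_def periodic_law_def)
  hence "F 0 0 - F 1 0 = 0" using c three_law_two_sites(3)[OF k, of a] by (simp add: F_def)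
  thus False using three_law_two_sites(1)[OF k, of a] x xk by (simp add: F_def x_def)
qed

text \<open>Parameters and measures correspond one to one: \<open>ex\<close> gives existence,
  \<open>associated_measure_unique\<close> allows one measure per law, and
  \<open>three_law_measure_inj\<close> separates the parameters. The trivial law a = 1 is removed
  from the level set. Emptiness is a separate claim because \<open>card\<close> is 0 on infinite
  sets too.\<close>

lemma card_ggms_of_three_laws:
  assumes T: "cayley_tree k V L" and k: "k \<ge> 2" and r: "r \<in> V" and b: "\<beta> > 0"
    and ex: "\<And>l. homogeneous_boundary_law k \<beta> l \<Longrightarrow> periodic_law 3 l \<Longrightarrow>
      \<exists>\<nu>. associated_measure V L r \<beta> 3 l \<nu> \<and> gradient_gibbs_measure V L r \<beta> \<nu>"
  defines "S \<equiv> {a. 0 < a \<and> tau_curve k a = 2 * cosh \<beta> - 2} - {1}"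
  shows "card (ggms_of V L r \<beta> 3 (nontrivial_three_laws k \<beta>)) = card S"
    and "S = {} \<Longrightarrow> ggms_of V L r \<beta> 3 (nontrivial_three_laws k \<beta>) = {}"
proof -
  have law: "homogeneous_boundary_law k \<beta> (three_law k a) \<longleftrightarrow> a \<in> S" if "0 < a" "a \<noteq> 1" for a
    using homogeneous_boundary_law_three_law_iff[OF b, of k a] three_law_equation_iff[OF k that] that k
    by (simp add: S_def)
  have laws: "nontrivial_three_laws k \<beta> = three_law k ` S"
    using law by (auto simp: nontrivial_three_laws_def S_def)
  define \<mu> where "\<mu> a = (SOME \<nu>. associated_measure V L r \<beta> 3 (three_law k a) \<nu> \<and> gradient_gibbs_measure V L r \<beta> \<nu>)" for a
  have \<mu>: "associated_measure V L r \<beta> 3 (three_law k a) (\<mu> a) \<and> gradient_gibbs_measure V L r \<beta> (\<mu> a)" if "a \<in> S" for a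
    unfolding \<mu>_def
    by (rule someI_ex, rule ex) (use that law[of a] in \<open>auto simp: S_def periodic_law_three_law\<close>)
  have im: "ggms_of V L r \<beta> 3 (nontrivial_three_laws k \<beta>) = \<mu> ` S"
  proof (intro equalityI subsetI)
    fix \<nu> assume "\<nu> \<in> ggms_of V L r \<beta> 3 (nontrivial_three_laws k \<beta>)"
    then obtain a where a: "a \<in> S" "associated_measure V L r \<beta> 3 (three_law k a) \<nu>"
      by (auto simp: ggms_of_def laws)
    hence "\<nu> = \<mu> a" using \<mu> associated_measure_unique[OF T r] by blast
    thus "\<nu> \<in> \<mu> ` S" using a by blast
  qed (use \<mu> in \<open>auto simp: ggms_of_def laws\<close>)
  have "inj_on \<mu> S"
  proof (rule inj_onI)
    fix a b assume ab: "a \<in> S" "b \<in> S" "\<mu> a = \<mu> b"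
    hence "associated_measure V L r \<beta> 3 (three_law k b) (\<mu> a)" using \<mu> by metis
    with ab(1,2) \<mu>[OF ab(1)] show "a = b"
      by (intro three_law_measure_inj[OF T k r]) (auto simp: S_def)
  qed
  thus "card (ggms_of V L r \<beta> 3 (nontrivial_three_laws k \<beta>)) = card S"
    unfolding im by (rule card_image)
  show "S = {} \<Longrightarrow> ggms_of V L r \<beta> 3 (nontrivial_three_laws k \<beta>) = {}" unfolding im by simp
qed

theorem theorem5:
  fixes k :: nat
  assumes k: "k \<ge> 2"
    and periodic_laws_define_ggms:
      "\<And>(V :: 'v set) L r \<beta> q l.
         cayley_tree k V L \<Longrightarrow> r \<in> V \<Longrightarrow> \<beta> > 0 \<Longrightarrow> q > 0 \<Longrightarrow>
         homogeneous_boundary_law k \<beta> l \<Longrightarrow> periodic_law q l \<Longrightarrow>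
         \<exists>\<nu>. associated_measure V L r \<beta> q l \<nu> \<and> gradient_gibbs_measure V L r \<beta> \<nu>"
  shows "\<exists>\<tau>\<^sub>c \<tau>\<^sub>0 :: real. 0 < \<tau>\<^sub>c \<and> \<tau>\<^sub>c < \<tau>\<^sub>0 \<and>
    (\<forall>(V :: 'v set) L r \<beta> \<tau>. cayley_tree k V L \<and> r \<in> V \<and> \<beta> > 0 \<and> \<tau> = 2 * cosh \<beta> \<longrightarrow>
       (\<tau> < \<tau>\<^sub>c \<longrightarrow> ggms_of V L r \<beta> 3 (nontrivial_three_laws k \<beta>) = {}) \<and>
       (\<tau> = \<tau>\<^sub>c \<longrightarrow> card (ggms_of V L r \<beta> 3 (nontrivial_three_laws k \<beta>)) = 1) \<and>
       (\<tau> > \<tau>\<^sub>c \<and> \<tau> \<noteq> \<tau>\<^sub>0 \<longrightarrow> card (ggms_of V L r \<beta> 3 (nontrivial_three_laws k \<beta>)) = 2) \<and>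
       (\<tau> = \<tau>\<^sub>0 \<longrightarrow> card (ggms_of V L r \<beta> 3 (nontrivial_three_laws k \<beta>)) = 1) \<and>
       (k = 2 \<longrightarrow> ggms_of V L r \<beta> 3 (nontrivial_three_laws k \<beta>) \<inter> ggms_of V L r \<beta> 4 (four_laws \<beta>) = {}))"
proof -
  obtain c where c: "0 < c" "c < 1" "tau_curve k c < tau_curve k 1"
    and below: "\<And>t. t < tau_curve k c \<Longrightarrow> {a. 0 < a \<and> tau_curve k a = t} = {}"
    and at: "{a. 0 < a \<and> tau_curve k a = tau_curve k c} = {c}"
    and above: "\<And>t. t > tau_curve k c \<Longrightarrow> card {a. 0 < a \<and> tau_curve k a = t} = 2"
    using tau_curve_level_sets[OF k] by blast
  \<comment> \<open>The curve has the values \<tau> - 2, hence the shift by 2: \<open>tc\<close>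
    comes from its minimum, \<open>t0\<close> from its value at the trivial a = 1.\<close>
  define tc where "tc = tau_curve k c + 2"
  define t0 where "t0 = tau_curve k 1 + 2"
  have tc: "0 < tc" using tau_curve_pos[OF k c(1)] by (simp add: tc_def)
  have t0: "tc < t0" using c(3) by (simp add: tc_def t0_def)
  have main: "(\<tau> < tc \<longrightarrow> ggms_of V L r \<beta> 3 (nontrivial_three_laws k \<beta>) = {}) \<and>
       (\<tau> = tc \<longrightarrow> card (ggms_of V L r \<beta> 3 (nontrivial_three_laws k \<beta>)) = 1) \<and>
       (\<tau> > tc \<and> \<tau> \<noteq> t0 \<longrightarrow> card (ggms_of V L r \<beta> 3 (nontrivial_three_laws k \<beta>)) = 2) \<and>
       (\<tau> = t0 \<longrightarrow> card (ggms_of V L r \<beta> 3 (nontrivial_three_laws k \<beta>)) = 1) \<and>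
       (k = 2 \<longrightarrow> ggms_of V L r \<beta> 3 (nontrivial_three_laws k \<beta>) \<inter> ggms_of V L r \<beta> 4 (four_laws \<beta>) = {})"
    if H: "cayley_tree k V L" "r \<in> V" "\<beta> > 0" "\<tau> = 2 * cosh \<beta>" for V :: "'v set" and L r \<beta> \<tau>
  proof -
    let ?A = "{a. 0 < a \<and> tau_curve k a = 2 * cosh \<beta> - 2}"
    have ex: "\<exists>\<nu>. associated_measure V L r \<beta> 3 l \<nu> \<and> gradient_gibbs_measure V L r \<beta> \<nu>"
      if "homogeneous_boundary_law k \<beta> l" "periodic_law 3 l" for l
      using periodic_laws_define_ggms[OF H(1-3) _ that] by simp
    note card = card_ggms_of_three_laws[OF H(1) k H(2,3) ex]
    have "ggms_of V L r \<beta> 3 (nontrivial_three_laws k \<beta>) = {}" if "\<tau> < tc"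
      using below[of "\<tau> - 2"] that H(4) by (intro card(2)) (simp_all add: tc_def)
    moreover have "card (?A - {1}) = 1" if "\<tau> = tc"
    proof -
      have "?A = {c}" using at that H(4) by (simp add: tc_def)
      thus ?thesis using c by simp
    qed
    \<comment> \<open>The value of the curve at a = 1 belongs to \<open>t0\<close> alone, so both
      points of the level set are nontrivial.\<close>
    moreover have "card (?A - {1}) = 2" if "\<tau> > tc \<and> \<tau> \<noteq> t0"
    proof -
      have "?A - {1} = ?A" using that H(4) by (auto simp: t0_def)
      thus ?thesis using above[of "\<tau> - 2"] that H(4) by (simp add: tc_def)
    qed
    \<comment> \<open>Here one of the two points of the level set is a = 1 and is discarded.\<close>
    moreover have "card (?A - {1}) = 1" if "\<tau> = t0"
    proof -
      have "1 \<in> ?A" using that H(4) by (simp add: t0_def)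
      moreover have "card ?A = 2" using above[of "\<tau> - 2"] that H(4) c(3) by (simp add: t0_def)
      ultimately show ?thesis by simp
    qed
    moreover have "ggms_of V L r \<beta> 3 (nontrivial_three_laws k \<beta>) \<inter> ggms_of V L r \<beta> 4 (four_laws \<beta>) = {}"
    proof (rule equals0I)
      fix \<nu> assume "\<nu> \<in> ggms_of V L r \<beta> 3 (nontrivial_three_laws k \<beta>) \<inter> ggms_of V L r \<beta> 4 (four_laws \<beta>)"
      then obtain a a' b' where "a > 0" "a \<noteq> 1" "associated_measure V L r \<beta> 3 (three_law k a) \<nu>"
          "associated_measure V L r \<beta> 4 (four_law a' b') \<nu>"
        by (auto simp: ggms_of_def nontrivial_three_laws_def four_laws_def)
      moreover have "periodic_law 4 (four_law a' b')"
        by (simp add: periodic_law_def four_law_def)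
      ultimately show False
        using three_law_measure_neq_four_law_measure[OF H(1) k H(2)] by blast
    qed
    ultimately show ?thesis using card(1) by metis
  qed
  show ?thesis
    by (rule exI[of _ tc], rule exI[of _ t0], rule conjI[OF tc conjI[OF t0]], intro allI impI, rule main) blast+
qed

end
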